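(* Let $k$ be a field of characteristic $0$, let $(M,+,0,<)$ be a partially ordered monoid and let $\mathbb{A}=k(\!(M)\!)$ be the algebra of Noetherian series with exponents in $M$. Then $(\mathrm{Der}^+_{\prec}(\mathbb{A}),\ast)$ and $(1\text{-}\mathrm{Aut}^+_k(\mathbb{A}),\circ)$ are groups, and the map $$\exp\colon(\mathrm{Der}^+_{\prec}(\mathbb{A}),\ast)\longrightarrow(1\text{-}\mathrm{Aut}^+_k(\mathbb{A}),\circ),\qquad \partial\longmapsto\sum_{n\in\mathbb{N}}\frac{\partial^{[n]}}{n!}$$ is a group isomorphism, where $\partial^{[n]}$ denotes the $n$-th iterate of $\partial$.
   Context: Algebras are associative over the field $k$. A partially ordered set is Noetherian if it has no infinite antichain and every non-empty chain in it has a minimal element. A partially ordered monoid is a (not necessarily commutative) monoid $(M,+,0)$ with a partial (strict) ordering $<$ such that $f<g$ implies $f+h<g+h$ and $h+f<h+g$. Noetherian series. For a non-empty partially ordered set $(\Omega,<)$, $\mathbf{H}_\Omega k$ is the vector space of maps $v\colon\Omega\to k$ whose support $\mathrm{supp}\,v=\{p:v(p)\ne0\}$ is Noetherian. A family $\mathbf{f}\colon I\to\mathbf{H}_\Omega k$ is summable if $\bigcup_{i\in I}\mathrm{supp}\,\mathbf{f}(i)$ is Noetherian and for every $p\in\Omega$ the set $\{i\in I:p\in\mathrm{supp}\,\mathbf{f}(i)\}$ is finite; its sum is $p\mapsto\sum_{i\in I}\mathbf{f}(i)(p)$. $k(\!(M)\!)=\mathbf{H}_M k$, with Cauchy product $(a\cdot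 b)(m)=\sum_{m_1+m_2=m}a(m_1)b(m_2)$, is a unital algebra. For $v,w\in\mathbf{H}_\Omega k$, write $v\prec w$ if $w\neq0$ and for every $p\in\mathrm{supp}\,v$ there is $q\in\mathrm{supp}\,w$ with $p>q$. A linear map $\phi$ on $\mathbf{H}_\Omega k$ is contracting if $\phi(v)\prec v$ for all $v\ne0$; it is strongly linear if for every summable family $\mathbf{v}\colon I\to \mathbf{H}_\Omega k$, $\phi\circ\mathbf{v}$ is summable with $\sum_{i\in I}\phi(\mathbf{v}(i))=\phi(\sum_{i\in I}\mathbf{v}(i))$. $\mathrm{Lin}^+_\prec(\mathbf{H}_\Omega k)$ is the set of contracting strongly linear maps. $\mathrm{Der}^+_\prec(\mathbb{A})$ is the set of contracting strongly linear maps $\partial\colon\mathbb{A}\to\mathbb{A}$ with $\partial(ab)=\partial(a)b+a\partial(b)$. $1\text{-}\mathrm{Aut}^+_k(\mathbb{A})$ is the set of bijective strongly linear algebra morphisms $\sigma\colon\mathbb{A}\to\mathbb{A}$ with $\sigma(a)-a\prec a$ for all $a\in\mathbb{A}\setminus\{0\}$. Sums of strongly linear maps: a family $(\phi_j)_{j\in J}$ of strongly linear maps is $\mathrm{Lin}$-summable if for every summable family $(v_i)_{i\in I}$ the family $(\phi_j(v_i))_{(i,j)\in I\times J}$ is summable; its sum is $v\mapsto\sum_{j\in J}\phi_j(v)$. For $\phi_0,\phi_1\in\mathrm{Lin}^+_\prec(\mathbb{A})$, all families obtained from compositions of $\phi_0,\phi_1$ indexed by finite words over $\{0,1\}$, with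 coefficients from $k$, are $\mathrm{Lin}$-summable. BCH operation. Let $X_0\ast X_1=\sum_{n\ge1}\frac{(-1)^{n+1}}{n}\sum \frac{1}{m_1!p_1!\cdots m_n!p_n!}X_0^{m_1}X_1^{p_1}\cdots X_0^{m_n}X_1^{p_n}$, a formal power series over $k$ in non-commuting variables, where the inner sum is over all $(m_1,p_1),\dots,(m_n,p_n)\in\mathbb{N}^2$ with $m_i+p_i\ge1$. With $P(\theta)$ the coefficient in it of the word $\theta\in\{0,1\}^\star=\bigcup_n\{0,1\}^n$, set $\phi_0\ast\phi_1=\sum_{\theta=(\theta_1,\dots,\theta_n)\in\{0,1\}^\star}P(\theta)\,\phi_{\theta_1}\circ\cdots\circ\phi_{\theta_n}$. *)

theory Defs
  imports Complex_Main "HOL-Algebra.Group" "HOL-Library.Infinite_Set"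
begin

definition noetherian :: "'w::order set \<Rightarrow> bool" where
  "noetherian S \<longleftrightarrow>
     (\<forall>A\<subseteq>S. (\<forall>x\<in>A. \<forall>y\<in>A. \<not> x < y) \<longrightarrow> finite A) \<and>
     (\<forall>C\<subseteq>S. C \<noteq> {} \<and> Complete_Partial_Order.chain (\<le>) C \<longrightarrow> (\<exists>m\<in>C. \<forall>x\<in>C. \<not> x < m))"

lemma noetherian_minimal:
  fixes S :: "'w::order set"
  assumes S: "noetherian S" and A: "A \<subseteq> S" "x \<in> A"
  obtains m where "m \<in> A" "m \<le> x" "\<And>y. y \<in> A \<Longrightarrow> \<not> y < m"
proof (rule ccontr)
  assume "\<not> thesis"
  with that have step: "\<exists>y\<in>A. y < m" if "m \<in> A" "m \<le> x" for m
    using \<open>m \<in> A\<close> \<open>m \<le> x\<close> by blast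
  have "\<exists>g. \<forall>n::nat. (g n \<in> A \<and> g n \<le> x) \<and> g (Suc n) < g n"
  proof (rule dependent_nat_choice)
    fix m and n :: nat assume "m \<in> A \<and> m \<le> x"
    then show "\<exists>y. (y \<in> A \<and> y \<le> x) \<and> y < m"
      using step[of m] by (meson less_imp_le order_trans)
  qed (use A in blast)
  then obtain g where g: "\<And>n::nat. g n \<in> A" "\<And>n. g (Suc n) < g n" by blast
  have dec: "g j \<le> g i" if "i \<le> j" for i j
    using that by (rule lift_Suc_antimono_le[of g, rotated]) (simp add: g(2) less_imp_le)
  have "Complete_Partial_Order.chain (\<le>) (range g)"
    unfolding Complete_Partial_Order.chain_def using dec nat_le_linear by blast
  moreover have "range g \<subseteq> S" using g(1) A(1) by blast
  ultimately have "\<exists>m\<in>range g. \<forall>x\<in>range g. \<not> x < m"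
    using S unfolding noetherian_def by blast
  then show False using g(2) by blast
qed

lemma noetherian_good:
  fixes f :: "nat \<Rightarrow> 'w::order"
  assumes S: "noetherian S" and f: "\<And>n. f n \<in> S"
  obtains i j where "i < j" "f i \<le> f j"
proof -
  let ?A = "{m \<in> range f. \<forall>y\<in>range f. \<not> y < m}"
  have sub: "range f \<subseteq> S" using f by blast
  have "?A \<subseteq> S" "\<forall>x\<in>?A. \<forall>y\<in>?A. \<not> x < y" using sub by blast+
  then have "finite ?A" using S unfolding noetherian_def by blast
  then have "finite (inv_into UNIV f ` ?A)" by simp
  then obtain N where N: "\<forall>i \<in> inv_into UNIV f ` ?A. i < N"
    unfolding finite_nat_set_iff_bounded by blast
  obtain m where m: "m \<in> range f" "m \<le> f N" "\<And>y. y \<in> range f \<Longrightarrow> \<not> y < m"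
    using noetherian_minimal[OF S sub, of "f N"] by blast
  then have "inv_into UNIV f m < N" "f (inv_into UNIV f m) = m"
    using N by (blast, simp add: f_inv_into_f)
  then show thesis using that m(2) by metis
qed

lemma noetherian_subseq:
  fixes f :: "nat \<Rightarrow> 'w::order"
  assumes S: "noetherian S" and f: "\<And>n. f n \<in> S"
  shows "\<exists>r :: nat \<Rightarrow> nat. strict_mono r \<and> (\<forall>i j. i \<le> j \<longrightarrow> f (r i) \<le> f (r j))"
proof -
  let ?T = "{i. \<forall>j>i. \<not> f i \<le> f j}"
  have "finite ?T"
  proof (rule ccontr)
    assume T: "infinite ?T"
    obtain i j where ij: "i < j" "f (enumerate ?T i) \<le> f (enumerate ?T j)"
      using noetherian_good[OF S, of "\<lambda>n. f (enumerate ?T n)"] f by blast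
    show False
      using enumerate_in_set[OF T, of i] ij strict_monoD[OF strict_mono_enumerate[OF T] ij(1)]
      by blast
  qed
  then obtain N where N: "\<forall>i\<in>?T. i < N"
    unfolding finite_nat_set_iff_bounded by blast
  have "\<exists>r. \<forall>n::nat. N \<le> r n \<and> (r n < r (Suc n) \<and> f (r n) \<le> f (r (Suc n)))"
  proof (rule dependent_nat_choice)
    fix i and n :: nat assume "N \<le> i"
    then have "i \<notin> ?T" using N leD by blast
    then show "\<exists>j. N \<le> j \<and> (i < j \<and> f i \<le> f j)" using \<open>N \<le> i\<close> by fastforce
  qed blast
  then obtain r where r: "\<And>n. r n < r (Suc n)" "\<And>n. f (r n) \<le> f (r (Suc n))" by blast
  have "strict_mono r" using r(1) by (simp add: strict_mono_Suc_iff)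
  moreover have "f (r i) \<le> f (r j)" if "i \<le> j" for i j
    using that by (rule lift_Suc_mono_le[of "\<lambda>n. f (r n)", rotated]) (rule r(2))
  ultimately show ?thesis by blast
qed

lemma noetherianI:
  fixes S :: "'w::order set"
  assumes good: "\<And>f :: nat \<Rightarrow> 'w. (\<And>n. f n \<in> S) \<Longrightarrow> \<exists>i j. i < j \<and> f i \<le> f j"
  shows "noetherian S"
  unfolding noetherian_def
proof (intro conjI allI impI)
  fix A assume A: "A \<subseteq> S" "\<forall>x\<in>A. \<forall>y\<in>A. \<not> x < y"
  show "finite A"
  proof (rule ccontr)
    assume "infinite A"
    then obtain f :: "nat \<Rightarrow> 'w" where f: "inj f" "range f \<subseteq> A"
      using infinite_countable_subset by blast
    then obtain i j where "i < j" "f i \<le> f j" using good[of f] A(1) by blast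
    moreover have "f i \<noteq> f j" using f(1) \<open>i < j\<close> by (auto dest: injD)
    ultimately show False using A(2) f(2) by (metis order_le_imp_less_or_eq rangeI subsetD)
  qed
next
  fix C assume C: "C \<subseteq> S" "C \<noteq> {} \<and> Complete_Partial_Order.chain (\<le>) C"
  show "\<exists>m\<in>C. \<forall>x\<in>C. \<not> x < m"
  proof (rule ccontr)
    assume "\<not> ?thesis"
    then have step: "\<forall>m\<in>C. \<exists>x\<in>C. x < m" by blast
    from C obtain c where c: "c \<in> C" by blast
    from step c have "\<exists>f. \<forall>n::nat. f n \<in> C \<and> f (Suc n) < f n"
      by (intro dependent_nat_choice) auto
    then obtain f :: "nat \<Rightarrow> 'w" where f: "\<And>n. f n \<in> C" "\<And>n. f (Suc n) < f n" by blast
    have "f j < f i" if "i < j" for i j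
      using that
    proof (induction j)
      case (Suc j)
      then show ?case using f(2)[of j] by (metis less_SucE order_less_trans)
    qed simp
    then show False using good[of f] f(1) C(1) by (meson leD subsetD)
  qed
qed

lemma noetherian_subset: "noetherian T \<Longrightarrow> S \<subseteq> T \<Longrightarrow> noetherian S"
  unfolding noetherian_def by (simp add: subset_trans)

lemma noetherian_finite:
  assumes "finite S" shows "noetherian S"
proof (rule noetherianI)
  fix f :: "nat \<Rightarrow> 'a" assume "\<And>n. f n \<in> S"
  then have "finite (range f)" using assms by (meson finite_subset image_subsetI)
  then have "\<not> inj f" using finite_imageD infinite_UNIV_nat by blast
  then obtain i j where "i < j" "f i = f j" unfolding inj_def by (metis linorder_neqE_nat)
  then show "\<exists>i j. i < j \<and> f i \<le> f j" by fastforce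
qed

lemma noetherian_Un:
  assumes "noetherian S" "noetherian T" shows "noetherian (S \<union> T)"
proof (rule noetherianI)
  fix f :: "nat \<Rightarrow> 'a" assume f: "\<And>n. f n \<in> S \<union> T"
  have *: "\<exists>i j. i < j \<and> f i \<le> f j" if inf: "infinite {n. f n \<in> R}" and R: "noetherian R" for R
  proof -
    let ?N = "{n. f n \<in> R}"
    have mem: "f (enumerate ?N n) \<in> R" for n
      using enumerate_in_set[OF inf, of n] by simp
    obtain i j where "i < j" "f (enumerate ?N i) \<le> f (enumerate ?N j)"
      by (rule noetherian_good[OF R, of "\<lambda>n. f (enumerate ?N n)"]) (rule mem)
    then show ?thesis using strict_monoD[OF strict_mono_enumerate[OF inf]] by blast
  qed
  have "UNIV = {n. f n \<in> S} \<union> {n. f n \<in> T}" using f by blast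
  then have "infinite {n. f n \<in> S} \<or> infinite {n. f n \<in> T}"
    by (metis finite_UnI infinite_UNIV_nat)
  then show "\<exists>i j. i < j \<and> f i \<le> f j" using * assms by blast
qed

text \<open>The type \<open>('w, 'k) nseries\<close> is the space of Noetherian series over the partially ordered set
  \<open>'w\<close>, and \<open>coeff v p\<close> is the value of \<open>v\<close> at \<open>p\<close>.\<close>

typedef (overloaded) ('w::order, 'k::zero) nseries =
    "{v :: 'w \<Rightarrow> 'k. noetherian {p. v p \<noteq> 0}}"
  morphisms coeff Abs_nseries
  by (rule exI[of _ "\<lambda>_. 0"]) (simp add: noetherian_finite)

setup_lifting type_definition_nseries

definition supp :: "('w::order, 'k::zero) nseries \<Rightarrow> 'w set" where
  "supp v = {p. coeff v p \<noteq> 0}"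

lemma noetherian_supp: "noetherian (supp v)"
  using coeff[of v] by (simp add: supp_def)

lemma nseries_eqI: "(\<And>p. coeff v p = coeff w p) \<Longrightarrow> v = w"
  by (simp add: coeff_inject[symmetric] fun_eq_iff)

lemma not_in_supp: "p \<notin> supp v \<longleftrightarrow> coeff v p = 0"
  by (simp add: supp_def)

instantiation nseries :: (order, ab_group_add) ab_group_add
begin

lift_definition zero_nseries :: "('a, 'b) nseries" is "\<lambda>_. 0"
  by (simp add: noetherian_finite)

lift_definition plus_nseries :: "('a, 'b) nseries \<Rightarrow> ('a, 'b) nseries \<Rightarrow> ('a, 'b) nseries"
  is "\<lambda>v w p. v p + w p"
  by (erule (1) noetherian_Un[THEN noetherian_subset]) auto

lift_definition uminus_nseries :: "('a, 'b) nseries \<Rightarrow> ('a, 'b) nseries"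
  is "\<lambda>v p. - v p" by simp

lift_definition minus_nseries :: "('a, 'b) nseries \<Rightarrow> ('a, 'b) nseries \<Rightarrow> ('a, 'b) nseries"
  is "\<lambda>v w p. v p - w p"
  by (erule (1) noetherian_Un[THEN noetherian_subset]) auto

instance
  by (standard; transfer) (auto simp: fun_eq_iff algebra_simps)

end

lift_definition scale :: "'k::field \<Rightarrow> ('w::order, 'k) nseries \<Rightarrow> ('w, 'k) nseries"
  is "\<lambda>c v p. c * v p"
  by (erule noetherian_subset) auto

lemma vector_space_scale: "vector_space scale"
  by (standard; transfer) (auto simp: fun_eq_iff algebra_simps)

lemma supp_zero: "supp 0 = {}"
  by (simp add: supp_def zero_nseries.rep_eq)

lemma supp_eq_empty_iff: "supp v = {} \<longleftrightarrow> v = 0"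
  by (auto simp: supp_def zero_nseries.rep_eq intro!: nseries_eqI)

class po_monoid = monoid_add + order +
  assumes po_add_strict_right_mono: "a < b \<Longrightarrow> a + c < b + c"
    and po_add_strict_left_mono: "a < b \<Longrightarrow> c + a < c + b"
begin

lemma po_add_right_mono: "a \<le> b \<Longrightarrow> a + c \<le> b + c"
  using po_add_strict_right_mono[of a b c] by (auto simp: le_less)

lemma po_add_left_mono: "a \<le> b \<Longrightarrow> c + a \<le> c + b"
  using po_add_strict_left_mono[of a b c] by (auto simp: le_less)

lemma po_add_mono: "a \<le> b \<Longrightarrow> c \<le> d \<Longrightarrow> a + c \<le> b + d"
  by (rule order_trans[OF po_add_right_mono po_add_left_mono])

lemma po_add_eq_mono:
  assumes "a \<le> b" "c \<le> d" "a + c = b + d"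
  shows "a = b \<and> c = d"
proof -
  have "\<not> a < b"
    using po_add_strict_right_mono[of a b c] po_add_left_mono[OF assms(2), of b] assms(3)
    by (auto dest: leD)
  then have "a = b" using assms(1) by (simp add: le_less)
  moreover have "\<not> c < d"
    using po_add_strict_left_mono[of c d b] assms(3) \<open>a = b\<close> by auto
  ultimately show ?thesis using assms(2) by (simp add: le_less)
qed

end

lemma noetherian_pair_subseq:
  fixes x y :: "nat \<Rightarrow> 'm::order"
  assumes "noetherian S" "noetherian T" and x: "\<And>n. x n \<in> S" and y: "\<And>n. y n \<in> T"
  obtains i j where "i < j" "x i \<le> x j" "y i \<le> y j"
proof -
  obtain r :: "nat \<Rightarrow> nat" where r: "strict_mono r" "\<forall>i j. i \<le> j \<longrightarrow> x (r i) \<le> x (r j)"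
    using noetherian_subseq[OF assms(1), of x] x by blast
  obtain s :: "nat \<Rightarrow> nat" where
      s: "strict_mono s" "\<forall>i j. i \<le> j \<longrightarrow> y (r (s i)) \<le> y (r (s j))"
    using noetherian_subseq[OF assms(2), of "\<lambda>n. y (r n)"] y by blast
  have "s 0 < s 1" using s(1) by (simp add: strict_mono_less)
  then have "r (s 0) < r (s 1)" "x (r (s 0)) \<le> x (r (s 1))"
    using r by (simp_all add: strict_mono_less)
  then show thesis using that s(2) by blast
qed

lemma noetherian_sumset:
  fixes S T :: "'m::po_monoid set"
  assumes "noetherian S" "noetherian T"
  shows "noetherian {m. \<exists>x\<in>S. \<exists>y\<in>T. m = x + y}"
proof (rule noetherianI)
  fix f :: "nat \<Rightarrow> 'm" assume "\<And>n. f n \<in> {m. \<exists>x\<in>S. \<exists>y\<in>T. m = x + y}"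
  then have "\<forall>n. \<exists>x y. x \<in> S \<and> y \<in> T \<and> f n = x + y" by blast
  then obtain x y where xy: "\<And>n. x n \<in> S" "\<And>n. y n \<in> T" "\<And>n. f n = x n + y n"
    by metis
  obtain i j where "i < j" "x i \<le> x j" "y i \<le> y j"
    by (rule noetherian_pair_subseq[OF assms xy(1,2)])
  then show "\<exists>i j. i < j \<and> f i \<le> f j" using xy(3) by (metis po_add_mono)
qed

lemma noetherian_finite_fibre:
  fixes S T :: "'m::po_monoid set"
  assumes "noetherian S" "noetherian T"
  shows "finite {(x, y). x + y = m \<and> x \<in> S \<and> y \<in> T}" (is "finite ?F")
proof (rule ccontr)
  assume "infinite ?F"
  then obtain f :: "nat \<Rightarrow> 'm \<times> 'm" where f: "inj f" "range f \<subseteq> ?F"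
    using infinite_countable_subset by blast
  have *: "fst (f n) \<in> S" "snd (f n) \<in> T" "fst (f n) + snd (f n) = m" for n
    using f(2) by (auto simp: image_subset_iff split_beta)
  obtain i j where ij: "i < j" "fst (f i) \<le> fst (f j)" "snd (f i) \<le> snd (f j)"
    by (rule noetherian_pair_subseq[OF assms, of "\<lambda>n. fst (f n)" "\<lambda>n. snd (f n)"]) (rule *)+
  then have "f i = f j" using po_add_eq_mono[OF ij(2,3)] *(3) by (simp add: prod_eq_iff)
  then show False using f(1) ij(1) by (auto dest: injD)
qed

text \<open>The product is the Cauchy product; restricting the summation to pairs in the supports makes
  the index set finite (\<open>noetherian_finite_fibre\<close>).\<close>

instantiation nseries :: (po_monoid, ring_1) ring_1
begin

lift_definition one_nseries :: "('a, 'b) nseries" is "\<lambda>m. if m = 0 then 1 else 0"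
  by (simp add: noetherian_finite)

lift_definition times_nseries :: "('a, 'b) nseries \<Rightarrow> ('a, 'b) nseries \<Rightarrow> ('a, 'b) nseries"
  is "\<lambda>a b m. \<Sum>(m1, m2) \<in> {(m1, m2). m1 + m2 = m \<and> a m1 \<noteq> 0 \<and> b m2 \<noteq> 0}. a m1 * b m2"
proof -
  fix a b :: "'a \<Rightarrow> 'b"
  let ?S = "{p. a p \<noteq> 0}" and ?T = "{p. b p \<noteq> 0}"
  assume "noetherian ?S" "noetherian ?T"
  then have "noetherian {m. \<exists>x\<in>?S. \<exists>y\<in>?T. m = x + y}" by (rule noetherian_sumset)
  then show "noetherian {m. (\<Sum>(m1, m2) \<in> {(m1, m2). m1 + m2 = m \<and> a m1 \<noteq> 0 \<and> b m2 \<noteq> 0}.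
      a m1 * b m2) \<noteq> 0}"
  proof (rule noetherian_subset, intro subsetI)
    fix m assume "m \<in> {m. (\<Sum>(m1, m2) \<in> {(m1, m2). m1 + m2 = m \<and> a m1 \<noteq> 0 \<and> b m2 \<noteq> 0}.
      a m1 * b m2) \<noteq> 0}"
    then have "{(m1, m2). m1 + m2 = m \<and> a m1 \<noteq> 0 \<and> b m2 \<noteq> 0} \<noteq> {}"
      by (metis (mono_tags, lifting) mem_Collect_eq sum.empty)
    then show "m \<in> {m. \<exists>x\<in>?S. \<exists>y\<in>?T. m = x + y}" by blast
  qed
qed

lemma coeff_times_on:
  fixes a b :: "('a, 'b) nseries"
  assumes "noetherian S" "noetherian T" "supp a \<subseteq> S" "supp b \<subseteq> T"
  shows "coeff (a * b) m = (\<Sum>(x, y) \<in> {(x, y). x + y = m \<and> x \<in> S \<and> y \<in> T}. coeff a x * coeff b y)"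
  unfolding times_nseries.rep_eq
proof (rule sum.mono_neutral_left)
  show "finite {(x, y). x + y = m \<and> x \<in> S \<and> y \<in> T}"
    by (rule noetherian_finite_fibre[OF assms(1,2)])
qed (use assms(3,4) in \<open>auto simp: supp_def\<close>)

lemma supp_plus: "supp (a + b) \<subseteq> supp a \<union> supp (b :: ('a, 'b) nseries)"
  by (auto simp: supp_def plus_nseries.rep_eq)

lemma supp_times:
  "supp (a * b) \<subseteq> {m. \<exists>x\<in>supp a. \<exists>y\<in>supp (b :: ('a, 'b) nseries). m = x + y}"
proof
  fix m assume "m \<in> supp (a * b)"
  then have "{(m1, m2). m1 + m2 = m \<and> coeff a m1 \<noteq> 0 \<and> coeff b m2 \<noteq> 0} \<noteq> {}"
    unfolding supp_def times_nseries.rep_eq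
    by (metis (mono_tags, lifting) mem_Collect_eq sum.empty)
  then show "m \<in> {m. \<exists>x\<in>supp a. \<exists>y\<in>supp b. m = x + y}" unfolding supp_def by blast
qed

instance
proof
  fix a b c :: "('a, 'b) nseries"
  note N = noetherian_supp
  note fib = noetherian_finite_fibre
  let ?A = "supp a" and ?B = "supp b" and ?C = "supp c"
  show "a * b * c = a * (b * c)"
  proof (rule nseries_eqI)
    fix m
    let ?AB = "{m. \<exists>x\<in>?A. \<exists>y\<in>?B. m = x + y}" and ?BC = "{m. \<exists>x\<in>?B. \<exists>y\<in>?C. m = x + y}"
    have AB: "noetherian ?AB" and BC: "noetherian ?BC"
      by (rule noetherian_sumset[OF N N])+
    have "coeff (a * b * c) m =
      (\<Sum>(u, z) \<in> {(u, z). u + z = m \<and> u \<in> ?AB \<and> z \<in> ?C}. coeff (a * b) u * coeff c z)"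
      by (rule coeff_times_on[OF AB N supp_times order_refl])
    also have "\<dots> = (\<Sum>p \<in> {(u, z). u + z = m \<and> u \<in> ?AB \<and> z \<in> ?C}.
        \<Sum>q \<in> {(x, y). x + y = fst p \<and> x \<in> ?A \<and> y \<in> ?B}.
          coeff a (fst q) * coeff b (snd q) * coeff c (snd p))"
      by (rule sum.cong)
         (auto simp: coeff_times_on[OF N N order_refl order_refl] sum_distrib_right split_beta)
    also have "\<dots> = (\<Sum>(p, q) \<in> (SIGMA p:{(u, z). u + z = m \<and> u \<in> ?AB \<and> z \<in> ?C}.
        {(x, y). x + y = fst p \<and> x \<in> ?A \<and> y \<in> ?B}).
          coeff a (fst q) * coeff b (snd q) * coeff c (snd p))"
      by (rule sum.Sigma) (rule fib[OF AB N], rule ballI, rule fib[OF N N])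
    also have "\<dots> = (\<Sum>(p, q) \<in> (SIGMA p:{(x, u). x + u = m \<and> x \<in> ?A \<and> u \<in> ?BC}.
        {(y, z). y + z = snd p \<and> y \<in> ?B \<and> z \<in> ?C}).
          coeff a (fst p) * (coeff b (fst q) * coeff c (snd q)))"
      by (rule sum.reindex_bij_witness[
            where j = "\<lambda>((u, z), (x, y)). ((x, y + z), (y, z))"
              and i = "\<lambda>((x, u), (y, z)). ((x + y, z), (x, y))"])
         (auto simp: mult.assoc, (metis add.assoc)+)
    also have "\<dots> = (\<Sum>p \<in> {(x, u). x + u = m \<and> x \<in> ?A \<and> u \<in> ?BC}.
        \<Sum>q \<in> {(y, z). y + z = snd p \<and> y \<in> ?B \<and> z \<in> ?C}.
          coeff a (fst p) * (coeff b (fst q) * coeff c (snd q)))"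
      by (rule sum.Sigma[symmetric]) (rule fib[OF N BC], rule ballI, rule fib[OF N N])
    also have "\<dots> =
      (\<Sum>(x, u) \<in> {(x, u). x + u = m \<and> x \<in> ?A \<and> u \<in> ?BC}. coeff a x * coeff (b * c) u)"
      by (rule sum.cong)
         (auto simp: coeff_times_on[OF N N order_refl order_refl] sum_distrib_left split_beta)
    also have "\<dots> = coeff (a * (b * c)) m"
      by (rule coeff_times_on[OF N BC order_refl supp_times, symmetric])
    finally show "coeff (a * b * c) m = coeff (a * (b * c)) m" .
  qed
  have one: "supp (1 :: ('a, 'b) nseries) = {0}"
    by (auto simp: supp_def one_nseries.rep_eq)
  have N1: "noetherian {0 :: 'a}" by (simp add: noetherian_finite)
  show "1 * a = a"
  proof (rule nseries_eqI)
    fix m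
    have "{(x, y). x + y = m \<and> x \<in> {0} \<and> y \<in> ?A} = (if m \<in> ?A then {(0, m)} else {})"
      by auto
    then show "coeff (1 * a) m = coeff a m"
      using coeff_times_on[OF N1 N equalityD1[OF one] order_refl, of a m]
      by (auto simp: one_nseries.rep_eq not_in_supp split: if_splits)
  qed
  show "a * 1 = a"
  proof (rule nseries_eqI)
    fix m
    have "{(x, y). x + y = m \<and> x \<in> ?A \<and> y \<in> {0}} = (if m \<in> ?A then {(m, 0)} else {})"
      by auto
    then show "coeff (a * 1) m = coeff a m"
      using coeff_times_on[OF N N1 order_refl equalityD1[OF one], of a m]
      by (auto simp: one_nseries.rep_eq not_in_supp split: if_splits)
  qed
  show "(a + b) * c = a * c + b * c"
  proof (rule nseries_eqI)
    fix m
    have AB: "noetherian (?A \<union> ?B)" by (rule noetherian_Un[OF N N])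
    show "coeff ((a + b) * c) m = coeff (a * c + b * c) m"
      by (simp add: coeff_times_on[OF AB N supp_plus order_refl]
          coeff_times_on[OF AB N Un_upper1 order_refl] coeff_times_on[OF AB N Un_upper2 order_refl]
          plus_nseries.rep_eq split_beta sum.distrib distrib_right)
  qed
  show "a * (b + c) = a * b + a * c"
  proof (rule nseries_eqI)
    fix m
    have BC: "noetherian (?B \<union> ?C)" by (rule noetherian_Un[OF N N])
    show "coeff (a * (b + c)) m = coeff (a * b + a * c) m"
      by (simp add: coeff_times_on[OF N BC order_refl supp_plus]
          coeff_times_on[OF N BC order_refl Un_upper1] coeff_times_on[OF N BC order_refl Un_upper2]
          plus_nseries.rep_eq split_beta sum.distrib distrib_left)
  qed
  show "(0 :: ('a, 'b) nseries) \<noteq> 1"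
    by (metis one supp_zero insert_not_empty)
qed

end

definition summable_family :: "'i set \<Rightarrow> ('i \<Rightarrow> ('w::order, 'k::zero) nseries) \<Rightarrow> bool" where
  "summable_family I v \<longleftrightarrow>
     noetherian (\<Union>i\<in>I. supp (v i)) \<and> (\<forall>p. finite {i\<in>I. p \<in> supp (v i)})"

text \<open>Only meaningful for summable families, see \<open>coeff_nsum\<close>.\<close>

definition nsum :: "'i set \<Rightarrow> ('i \<Rightarrow> ('w::order, 'k::ab_group_add) nseries) \<Rightarrow> ('w, 'k) nseries" where
  "nsum I v = Abs_nseries (\<lambda>p. \<Sum>i \<in> {i\<in>I. p \<in> supp (v i)}. coeff (v i) p)"

lemma coeff_nsum:
  assumes "summable_family I v"
  shows "coeff (nsum I v) p = (\<Sum>i \<in> {i\<in>I. p \<in> supp (v i)}. coeff (v i) p)"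
proof -
  let ?s = "\<lambda>p. \<Sum>i \<in> {i\<in>I. p \<in> supp (v i)}. coeff (v i) p"
  have "{p. ?s p \<noteq> 0} \<subseteq> (\<Union>i\<in>I. supp (v i))"
  proof
    fix p assume "p \<in> {p. ?s p \<noteq> 0}"
    then have "{i\<in>I. p \<in> supp (v i)} \<noteq> {}" by (metis (mono_tags, lifting) mem_Collect_eq sum.empty)
    then show "p \<in> (\<Union>i\<in>I. supp (v i))" by blast
  qed
  then have "noetherian {p. ?s p \<noteq> 0}"
    using assms unfolding summable_family_def by (blast intro: noetherian_subset)
  then show ?thesis unfolding nsum_def by (simp add: Abs_nseries_inverse)
qed

text \<open>A summable family over \<open>'w\<close> has at most \<open>|nat \<times> 'w|\<close> non-zero members. Hence it suffices to
  quantify over index sets of type \<open>nat \<times> 'w\<close>; \<open>strongly_linear_summable\<close> and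
  \<open>strongly_linear_nsum\<close> below give the defining property for index sets of any type.\<close>

definition strongly_linear ::
    "(('w::order, 'k::field) nseries \<Rightarrow> ('w, 'k) nseries) \<Rightarrow> bool" where
  "strongly_linear \<phi> \<longleftrightarrow>
     Vector_Spaces.linear scale scale \<phi> \<and>
     (\<forall>(I :: (nat \<times> 'w) set) v. summable_family I v \<longrightarrow>
        summable_family I (\<lambda>i. \<phi> (v i)) \<and> nsum I (\<lambda>i. \<phi> (v i)) = \<phi> (nsum I v))"

lemma nsum_reindex:
  fixes v :: "'i \<Rightarrow> ('w::order, 'k::ab_group_add) nseries" and g :: "'i \<Rightarrow> 'j"
  assumes N: "N \<subseteq> I" and inj: "inj_on g N" and zero: "\<And>i. i \<in> I - N \<Longrightarrow> v i = 0"
    and w: "\<And>i. i \<in> N \<Longrightarrow> w (g i) = v i"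
  shows "summable_family (g ` N) w \<longleftrightarrow> summable_family I v" and "nsum (g ` N) w = nsum I v"
proof -
  have z: "supp (v i) = {}" if "i \<in> I - N" for i using zero[OF that] by (simp add: supp_zero)
  have im: "{j \<in> g ` N. p \<in> supp (w j)} = g ` {i\<in>I. p \<in> supp (v i)}" for p
    using N z w by fastforce
  have inj': "inj_on g {i\<in>I. p \<in> supp (v i)}" for p
    by (rule inj_on_subset[OF inj]) (use z in blast)
  have "(\<Union>j\<in>g ` N. supp (w j)) = (\<Union>i\<in>I. supp (v i))"
    using N z w by fastforce
  then show "summable_family (g ` N) w \<longleftrightarrow> summable_family I v"
    by (simp add: summable_family_def im finite_image_iff[OF inj'])
  have "(\<Sum>j \<in> {j \<in> g ` N. p \<in> supp (w j)}. coeff (w j) p) =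
      (\<Sum>i \<in> {i\<in>I. p \<in> supp (v i)}. coeff (v i) p)" for p
    unfolding im sum.reindex[OF inj'] o_def
  proof (rule sum.cong)
    fix i assume "i \<in> {i\<in>I. p \<in> supp (v i)}"
    then have "i \<in> N" using z by blast
    then show "coeff (w (g i)) p = coeff (v i) p" using w by simp
  qed simp
  then show "nsum (g ` N) w = nsum I v" by (simp add: nsum_def)
qed

lemma strongly_linear_any_index:
  fixes v :: "'i \<Rightarrow> ('w::order, 'k::field) nseries"
  assumes \<phi>: "strongly_linear \<phi>" and v: "summable_family I v"
  shows "summable_family I (\<lambda>i. \<phi> (v i)) \<and> nsum I (\<lambda>i. \<phi> (v i)) = \<phi> (nsum I v)"
proof -
  define N where "N = {i\<in>I. v i \<noteq> 0}"
  have "\<forall>i\<in>N. \<exists>p. p \<in> supp (v i)" unfolding N_def using supp_eq_empty_iff by blast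
  then obtain p where p: "\<And>i. i \<in> N \<Longrightarrow> p i \<in> supp (v i)" by metis
  have "\<exists>e :: 'i \<Rightarrow> nat. inj_on e {i\<in>I. q \<in> supp (v i)}" for q
    using v finite_imp_inj_to_nat_seg unfolding summable_family_def by blast
  then obtain e :: "'w \<Rightarrow> 'i \<Rightarrow> nat" where e: "\<And>q. inj_on (e q) {i\<in>I. q \<in> supp (v i)}" by metis
  define g where "g i = (e (p i) i, p i)" for i
  have g: "inj_on g N"
  proof (rule inj_onI)
    fix i j assume ij: "i \<in> N" "j \<in> N" "g i = g j"
    then have "p i = p j" "e (p i) i = e (p i) j" by (auto simp: g_def)
    then show "i = j" using e[of "p i"] p[OF ij(1)] p[OF ij(2)] ij(1,2)
      unfolding N_def by (auto dest!: inj_onD)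
  qed
  have NI: "N \<subseteq> I" and z: "\<And>i. i \<in> I - N \<Longrightarrow> v i = 0" by (auto simp: N_def)
  have \<phi>0: "\<phi> 0 = 0"
    using \<phi> module_hom.zero unfolding strongly_linear_def Vector_Spaces.linear_def by blast
  define w where "w j = v (inv_into N g j)" for j
  have w: "w (g i) = v i" if "i \<in> N" for i using that g by (simp add: w_def)
  have w': "\<phi> (w (g i)) = \<phi> (v i)" if "i \<in> N" for i using w[OF that] by simp
  have z': "\<phi> (v i) = 0" if "i \<in> I - N" for i using z[OF that] \<phi>0 by simp
  have r: "summable_family (g ` N) w \<longleftrightarrow> summable_family I v" "nsum (g ` N) w = nsum I v"
    by (rule nsum_reindex[of N I g v w]; use NI g z w in blast)+
  have r': "summable_family (g ` N) (\<lambda>j. \<phi> (w j)) \<longleftrightarrow> summable_family I (\<lambda>i. \<phi> (v i))"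
      "nsum (g ` N) (\<lambda>j. \<phi> (w j)) = nsum I (\<lambda>i. \<phi> (v i))"
    by (rule nsum_reindex[of N I g "\<lambda>i. \<phi> (v i)" "\<lambda>j. \<phi> (w j)"]; use NI g z' w' in blast)+
  have "summable_family (g ` N) w" using r(1) v by blast
  then have "summable_family (g ` N) (\<lambda>j. \<phi> (w j)) \<and> nsum (g ` N) (\<lambda>j. \<phi> (w j)) = \<phi> (nsum (g ` N) w)"
    using \<phi> unfolding strongly_linear_def by blast
  then show ?thesis using r(2) r' by simp
qed

lemmas strongly_linear_summable = strongly_linear_any_index[THEN conjunct1]
lemmas strongly_linear_nsum = strongly_linear_any_index[THEN conjunct2]

text \<open>Pointwise sum of maps. A Lin-summable family (one for which \<open>(\<phi> j (v i))\<close> is a summable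
  family whenever \<open>v\<close> is) is in particular pointwise summable, so that \<open>nsum\<close> is meaningful here.\<close>

definition lin_sum :: "'j set \<Rightarrow> ('j \<Rightarrow> ('w::order, 'k::field) nseries \<Rightarrow> ('w, 'k) nseries) \<Rightarrow>
    ('w, 'k) nseries \<Rightarrow> ('w, 'k) nseries" where
  "lin_sum J \<phi> = (\<lambda>v. nsum J (\<lambda>j. \<phi> j v))"

definition prec :: "('w::order, 'k::ab_group_add) nseries \<Rightarrow> ('w, 'k) nseries \<Rightarrow> bool" (infix "\<prec>" 50) where
  "v \<prec> w \<longleftrightarrow> w \<noteq> 0 \<and> (\<forall>p\<in>supp v. \<exists>q\<in>supp w. p > q)"

definition contracting :: "(('w::order, 'k::field) nseries \<Rightarrow> ('w, 'k) nseries) \<Rightarrow> bool" where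
  "contracting \<phi> \<longleftrightarrow> Vector_Spaces.linear scale scale \<phi> \<and> (\<forall>v. v \<noteq> 0 \<longrightarrow> \<phi> v \<prec> v)"

definition Der :: "(('m::po_monoid, 'k::field) nseries \<Rightarrow> ('m, 'k) nseries) set" where
  "Der = {d. contracting d \<and> strongly_linear d \<and> (\<forall>a b. d (a * b) = d a * b + a * d b)}"

definition One_Aut :: "(('m::po_monoid, 'k::field) nseries \<Rightarrow> ('m, 'k) nseries) set" where
  "One_Aut = {\<sigma>. bij \<sigma> \<and> strongly_linear \<sigma> \<and> \<sigma> 1 = 1 \<and> (\<forall>a b. \<sigma> (a * b) = \<sigma> a * \<sigma> b) \<and>
                 (\<forall>a. a \<noteq> 0 \<longrightarrow> \<sigma> a - a \<prec> a)}"

definition lin_exp :: "(('w::order, 'k::field_char_0) nseries \<Rightarrow> ('w, 'k) nseries) \<Rightarrow>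
    ('w, 'k) nseries \<Rightarrow> ('w, 'k) nseries" where
  "lin_exp d = lin_sum UNIV (\<lambda>n::nat. \<lambda>v. scale (1 / fact n) ((d ^^ n) v))"

text \<open>Words over \<open>{0, 1}\<close> are Boolean lists, with \<open>False\<close> for \<open>0\<close> and \<open>True\<close> for \<open>1\<close>.
  A list \<open>[(m\<^sub>1, p\<^sub>1), \<dots>, (m\<^sub>n, p\<^sub>n)]\<close> stands for the monomial
  \<open>X\<^sub>0^m\<^sub>1 X\<^sub>1^p\<^sub>1 \<dots> X\<^sub>0^m\<^sub>n X\<^sub>1^p\<^sub>n\<close>, so that
  \<open>bch_coeff \<theta>\<close> collects the terms of all \<open>n \<ge> 1\<close> whose monomial is \<open>\<theta>\<close>.\<close>

definition bch_word :: "(nat \<times> nat) list \<Rightarrow> bool list" where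
  "bch_word mps = concat (map (\<lambda>(m, p). replicate m False @ replicate p True) mps)"

definition bch_terms :: "bool list \<Rightarrow> (nat \<times> nat) list set" where
  "bch_terms \<theta> = {mps. length mps \<ge> 1 \<and> (\<forall>(m, p)\<in>set mps. m + p \<ge> 1) \<and> bch_word mps = \<theta>}"

lemma finite_bch_terms: "finite (bch_terms \<theta>)"
proof -
  have *: "length mps \<le> length (bch_word mps) \<and>
      set mps \<subseteq> {..length (bch_word mps)} \<times> {..length (bch_word mps)}"
    if "\<forall>(m, p)\<in>set mps. m + p \<ge> 1" for mps
    using that by (induction mps) (force simp: bch_word_def)+
  have "bch_terms \<theta> \<subseteq> {mps. set mps \<subseteq> {..length \<theta>} \<times> {..length \<theta>} \<and> length mps \<le> length \<theta>}"
    unfolding bch_terms_def using * by blast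
  then show ?thesis
    by (rule finite_subset) (intro finite_lists_length_le finite_cartesian_product finite_atMost)
qed

definition bch_coeff :: "bool list \<Rightarrow> 'k::field_char_0" where
  "bch_coeff \<theta> = (\<Sum>mps \<in> bch_terms \<theta>.
     (-1) ^ (length mps + 1) / of_nat (length mps) *
     (1 / prod_list (map (\<lambda>(m, p). fact m * fact p) mps)))"

definition word_comp :: "('a \<Rightarrow> 'a) \<Rightarrow> ('a \<Rightarrow> 'a) \<Rightarrow> bool list \<Rightarrow> 'a \<Rightarrow> 'a" where
  "word_comp \<phi>0 \<phi>1 \<theta> = foldr (\<lambda>t f. (if t then \<phi>1 else \<phi>0) \<circ> f) \<theta> id"

definition bch :: "(('w::order, 'k::field_char_0) nseries \<Rightarrow> ('w, 'k) nseries) \<Rightarrow>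
    (('w, 'k) nseries \<Rightarrow> ('w, 'k) nseries) \<Rightarrow> ('w, 'k) nseries \<Rightarrow> ('w, 'k) nseries" where
  "bch \<phi>0 \<phi>1 = lin_sum UNIV (\<lambda>\<theta> v. scale (bch_coeff \<theta>) (word_comp \<phi>0 \<phi>1 \<theta> v))"

text \<open>The neutral element for \<open>bch\<close> is the zero derivation.\<close>

definition Der_group :: "(('m::po_monoid, 'k::field_char_0) nseries \<Rightarrow> ('m, 'k) nseries) monoid" where
  "Der_group = \<lparr>carrier = Der, mult = bch, one = (\<lambda>_. 0)\<rparr>"

definition One_Aut_group :: "(('m::po_monoid, 'k::field_char_0) nseries \<Rightarrow> ('m, 'k) nseries) monoid" where
  "One_Aut_group = \<lparr>carrier = One_Aut, mult = (\<circ>), one = id\<rparr>"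

end

theory Submission
  imports
    "HOL-Computational_Algebra.Formal_Power_Series"
    "HOL-Computational_Algebra.Polynomial"
    Defs
begin

text \<open>
  Everything rests on a functional calculus. If \<open>\<psi>\<close> is contracting and strongly linear, then a formal
  power series \<open>f\<close> can be evaluated at \<open>\<psi>\<close> (\<open>fps_eval\<close>), and this evaluation respects products
  (\<open>fps_eval_mult\<close>) and substitution (\<open>fps_eval_compose\<close>). The familiar identities between the power
  series \<open>exp\<close> and \<open>log\<close> thus show that \<open>lin_exp\<close> and \<open>lin_log\<close> are mutually inverse bijections
  between the contracting strongly linear maps and the maps \<open>\<sigma>\<close> for which \<open>\<sigma> - id\<close> is one.

  The convergence behind this is a combinatorial fact (\<open>summable_family_words\<close>): if two maps are
  contracting and strongly linear, then all their words, applied to a summable family, form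
  a summable family again. A minimal bad sequence argument on paths of exponents proves it
  (\<open>paths_good\<close>).

  Under these bijections derivations correspond to automorphisms. By the Leibniz rule for iterates,
  the exponential of a derivation is multiplicative (\<open>lin_exp_One_Aut\<close>). Conversely, if
  \<open>\<sigma> = exp d\<close> is multiplicative, then so are all \<open>\<sigma>\<^sup>N = exp (N d)\<close>; both sides of the
  multiplicativity of \<open>exp (N d)\<close> are, exponent by exponent, polynomials in \<open>N\<close>, and since they agree
  for infinitely many \<open>N\<close> they have the same linear coefficient, which is the Leibniz rule for \<open>d\<close>
  (\<open>lin_log_Der\<close>).

  Finally \<open>bch d e = log (exp d \<circ> exp e)\<close> (\<open>bch_eq_log\<close>): expand the logarithm, and collect the terms by
  the words that they contain. So \<open>bch\<close> is the composition of automorphisms transported along the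
  bijection \<open>lin_exp\<close>, and the group structure is transported with it.
\<close>

section \<open>Sums of summable families\<close>

lemma nsum_coeff_superset:
  assumes v: "summable_family I v" and F: "finite F" "F \<subseteq> I" "{i\<in>I. p \<in> supp (v i)} \<subseteq> F"
  shows "coeff (nsum I v) p = (\<Sum>i\<in>F. coeff (v i) p)"
  unfolding coeff_nsum[OF v]
  by (rule sum.mono_neutral_left) (use F in \<open>auto simp: supp_def\<close>)

lemma supp_nsum: "summable_family I v \<Longrightarrow> supp (nsum I v) \<subseteq> (\<Union>i\<in>I. supp (v i))"
proof
  fix p assume v: "summable_family I v" and "p \<in> supp (nsum I v)"
  then have "(\<Sum>i \<in> {i\<in>I. p \<in> supp (v i)}. coeff (v i) p) \<noteq> 0"
    by (simp add: supp_def coeff_nsum[OF v, unfolded supp_def])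
  then have "{i\<in>I. p \<in> supp (v i)} \<noteq> {}" by (metis (mono_tags, lifting) sum.empty)
  then show "p \<in> (\<Union>i\<in>I. supp (v i))" by blast
qed

lemma summable_family_finite: "finite I \<Longrightarrow> summable_family I v"
proof -
  assume I: "finite I"
  have "noetherian (\<Union>i\<in>I. supp (v i))"
    using I by (induction I) (auto intro: noetherian_Un noetherian_supp noetherian_finite)
  then show ?thesis using I unfolding summable_family_def by simp
qed

lemma supp_scale: "supp (scale c v) \<subseteq> supp v"
  by (auto simp: supp_def scale.rep_eq)

lemma coeff_sum: "coeff (\<Sum>i\<in>I. v i) p = (\<Sum>i\<in>I. coeff (v i) p)"
  by (induction I rule: infinite_finite_induct) (auto simp: zero_nseries.rep_eq plus_nseries.rep_eq)

lemma nsum_finite: "finite I \<Longrightarrow> nsum I v = (\<Sum>i\<in>I. v i)"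
  by (rule nseries_eqI)
    (simp add: nsum_coeff_superset[OF summable_family_finite, of I I] coeff_sum)

lemma nsum_cong: "(\<And>i. i \<in> I \<Longrightarrow> v i = w i) \<Longrightarrow> nsum I v = nsum I w"
  using nsum_reindex(2)[of I I "\<lambda>i. i" v w] by simp

text \<open>Finite-to-one domination. Most families below get their summability from the family of all
  words in contracting maps, by discarding, rescaling or finitely repeating its members.\<close>

lemma summable_family_pullback:
  fixes u :: "'i \<Rightarrow> ('w::order, 'k::ab_group_add) nseries"
  assumes w: "summable_family J w"
    and h: "\<And>i. i \<in> I \<Longrightarrow> u i \<noteq> 0 \<Longrightarrow> h i \<in> J \<and> supp (u i) \<subseteq> supp (w (h i))"
    and fin: "\<And>j. j \<in> J \<Longrightarrow> finite {i\<in>I. u i \<noteq> 0 \<and> h i = j}"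
  shows "summable_family I u"
  unfolding summable_family_def
proof
  have nz: "u i \<noteq> 0" if "p \<in> supp (u i)" for i p
    using that by (auto simp: supp_zero)
  have "(\<Union>i\<in>I. supp (u i)) \<subseteq> (\<Union>j\<in>J. supp (w j))"
    using h nz by blast
  then show "noetherian (\<Union>i\<in>I. supp (u i))"
    using w noetherian_subset unfolding summable_family_def by blast
  show "\<forall>p. finite {i\<in>I. p \<in> supp (u i)}"
  proof
    fix p
    have "{i\<in>I. p \<in> supp (u i)} \<subseteq> (\<Union>j\<in>{j\<in>J. p \<in> supp (w j)}. {i\<in>I. u i \<noteq> 0 \<and> h i = j})"
      using h nz by blast
    moreover have "finite (\<Union>j\<in>{j\<in>J. p \<in> supp (w j)}. {i\<in>I. u i \<noteq> 0 \<and> h i = j})"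
      using w fin unfolding summable_family_def by blast
    ultimately show "finite {i\<in>I. p \<in> supp (u i)}" by (rule finite_subset)
  qed
qed

lemma summable_family_dominated:
  fixes u :: "'i \<Rightarrow> ('w::order, 'k::ab_group_add) nseries"
  assumes "summable_family I w" "\<And>i. i \<in> I \<Longrightarrow> supp (u i) \<subseteq> supp (w i)"
  shows "summable_family I u"
  by (rule summable_family_pullback[OF assms(1), of I u "\<lambda>i. i"]) (use assms(2) in auto)

lemma summable_family_subset:
  fixes u :: "'i \<Rightarrow> ('w::order, 'k::ab_group_add) nseries"
  shows "summable_family I u \<Longrightarrow> A \<subseteq> I \<Longrightarrow> summable_family A u"
  by (rule summable_family_pullback[of I u A u "\<lambda>i. i"]) auto

text \<open>Fubini's theorem in its general form: a sum may be grouped along the fibres of any map. At a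
  given exponent only finitely many terms contribute, so this is the grouping of a finite sum.
  Exchanging two summations, collecting equal powers and collecting equal words are instances.\<close>

lemma
  fixes u :: "'i \<Rightarrow> ('w::order, 'k::ab_group_add) nseries"
  assumes u: "summable_family I u" and h: "h ` I \<subseteq> J"
  shows summable_family_fibres: "summable_family J (\<lambda>j. nsum {i\<in>I. h i = j} u)" (is ?s)
    and nsum_fibres: "nsum J (\<lambda>j. nsum {i\<in>I. h i = j} u) = nsum I u" (is ?n)
proof -
  have sub: "summable_family {i\<in>I. h i = j} u" for j
    by (rule summable_family_subset[OF u]) blast
  have sup: "supp (nsum {i\<in>I. h i = j} u) \<subseteq> (\<Union>i\<in>{i\<in>I. h i = j}. supp (u i))" for j
    by (rule supp_nsum[OF sub])
  have "(\<Union>j\<in>J. supp (nsum {i\<in>I. h i = j} u)) \<subseteq> (\<Union>i\<in>I. supp (u i))"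
    using sup by blast
  moreover have fin: "finite {i\<in>I. p \<in> supp (u i)}" for p
    using u unfolding summable_family_def by blast
  have im: "{j\<in>J. p \<in> supp (nsum {i\<in>I. h i = j} u)} \<subseteq> h ` {i\<in>I. p \<in> supp (u i)}" for p
    using sup by blast
  then have "finite {j\<in>J. p \<in> supp (nsum {i\<in>I. h i = j} u)}" for p
    by (rule finite_subset) (intro finite_imageI fin)
  ultimately show s: ?s
    using u noetherian_subset unfolding summable_family_def by blast
  show ?n
  proof (rule nseries_eqI)
    fix p
    let ?A = "{i\<in>I. p \<in> supp (u i)}"
    have "coeff (nsum J (\<lambda>j. nsum {i\<in>I. h i = j} u)) p =
        (\<Sum>j\<in>h ` ?A. coeff (nsum {i\<in>I. h i = j} u) p)"
      by (rule nsum_coeff_superset[OF s]) (use fin h im in auto)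
    also have "\<dots> = (\<Sum>j\<in>h ` ?A. \<Sum>i\<in>{i\<in>?A. h i = j}. coeff (u i) p)"
    proof (rule sum.cong)
      fix j assume "j \<in> h ` ?A"
      show "coeff (nsum {i\<in>I. h i = j} u) p = (\<Sum>i\<in>{i\<in>?A. h i = j}. coeff (u i) p)"
        by (rule nsum_coeff_superset[OF sub])
          (use finite_subset[OF _ fin[of p], of "{i\<in>?A. h i = j}"] in auto)
    qed simp
    also have "\<dots> = (\<Sum>i\<in>?A. coeff (u i) p)"
      by (rule sum.image_gen[OF fin, symmetric])
    also have "\<dots> = coeff (nsum I u) p" by (rule coeff_nsum[OF u, symmetric])
    finally show "coeff (nsum J (\<lambda>j. nsum {i\<in>I. h i = j} u)) p = coeff (nsum I u) p" .
  qed
qed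

lemma
  fixes u :: "'a \<times> 'b \<Rightarrow> ('w::order, 'k::ab_group_add) nseries"
  assumes u: "summable_family (A \<times> B) u"
  shows summable_family_iterated: "summable_family A (\<lambda>a. nsum B (\<lambda>b. u (a, b)))"
    and nsum_iterated: "nsum A (\<lambda>a. nsum B (\<lambda>b. u (a, b))) = nsum (A \<times> B) u"
proof -
  have *: "nsum {i \<in> A \<times> B. fst i = a} u = nsum B (\<lambda>b. u (a, b))" if "a \<in> A" for a
  proof -
    have "{i \<in> A \<times> B. fst i = a} = Pair a ` B" using that by auto
    then show ?thesis
      using nsum_reindex(2)[of B B "Pair a" "\<lambda>b. u (a, b)" u] by (simp add: inj_on_def)
  qed
  have fst: "fst ` (A \<times> B) \<subseteq> A" by auto
  show "nsum A (\<lambda>a. nsum B (\<lambda>b. u (a, b))) = nsum (A \<times> B) u"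
    unfolding nsum_fibres[OF u fst, symmetric] by (rule nsum_cong) (simp add: *)
  show "summable_family A (\<lambda>a. nsum B (\<lambda>b. u (a, b)))"
    using summable_family_fibres[OF u fst] by (rule summable_family_dominated) (simp add: *)
qed

lemma
  fixes u :: "'a \<times> 'b \<Rightarrow> ('w::order, 'k::ab_group_add) nseries"
  assumes u: "summable_family (A \<times> B) u"
  shows summable_family_swap: "summable_family (B \<times> A) (\<lambda>(b, a). u (a, b))"
    and nsum_swap: "nsum A (\<lambda>a. nsum B (\<lambda>b. u (a, b))) = nsum B (\<lambda>b. nsum A (\<lambda>a. u (a, b)))"
proof -
  have im: "prod.swap ` (A \<times> B) = B \<times> A" by auto
  have s: "summable_family (B \<times> A) (\<lambda>(b, a). u (a, b)) \<longleftrightarrow> summable_family (A \<times> B) u"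
      "nsum (B \<times> A) (\<lambda>(b, a). u (a, b)) = nsum (A \<times> B) u"
    using nsum_reindex[of "A \<times> B" "A \<times> B" prod.swap u "\<lambda>(b, a). u (a, b)"]
    unfolding im by auto
  then show "summable_family (B \<times> A) (\<lambda>(b, a). u (a, b))" using u by blast
  then show "nsum A (\<lambda>a. nsum B (\<lambda>b. u (a, b))) = nsum B (\<lambda>b. nsum A (\<lambda>a. u (a, b)))"
    using nsum_iterated[of B A "\<lambda>(b, a). u (a, b)"] nsum_iterated[OF u] s(2) by simp
qed

lemma
  assumes v: "summable_family I v" and w: "summable_family I w"
  shows summable_family_add: "summable_family I (\<lambda>i. v i + w i :: ('w::order, 'k::ab_group_add) nseries)"
    and nsum_add: "nsum I (\<lambda>i. v i + w i) = nsum I v + nsum I w"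
proof -
  have sup: "supp (v i + w i) \<subseteq> supp (v i) \<union> supp (w i)" for i
    by (auto simp: supp_def plus_nseries.rep_eq)
  have "(\<Union>i\<in>I. supp (v i + w i)) \<subseteq> (\<Union>i\<in>I. supp (v i)) \<union> (\<Union>i\<in>I. supp (w i))"
    using sup by blast
  then have "noetherian (\<Union>i\<in>I. supp (v i + w i))"
    using v w noetherian_Un noetherian_subset unfolding summable_family_def by blast
  moreover have fin: "finite ({i\<in>I. p \<in> supp (v i)} \<union> {i\<in>I. p \<in> supp (w i)})" for p
    using v w unfolding summable_family_def by blast
  moreover have sub: "{i\<in>I. p \<in> supp (v i + w i)} \<subseteq>
      {i\<in>I. p \<in> supp (v i)} \<union> {i\<in>I. p \<in> supp (w i)}" for p
    using sup by blast
  ultimately show s: "summable_family I (\<lambda>i. v i + w i)"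
    unfolding summable_family_def using finite_subset by blast
  show "nsum I (\<lambda>i. v i + w i) = nsum I v + nsum I w"
  proof (rule nseries_eqI)
    fix p
    note * = nsum_coeff_superset[of I _ "{i\<in>I. p \<in> supp (v i)} \<union> {i\<in>I. p \<in> supp (w i)}", OF _ fin]
    show "coeff (nsum I (\<lambda>i. v i + w i)) p = coeff (nsum I v + nsum I w) p"
      unfolding plus_nseries.rep_eq
      by (subst *[OF s _ sub], blast, subst *[OF v], blast, blast, subst *[OF w], blast, blast)
        (simp add: plus_nseries.rep_eq sum.distrib)
  qed
qed

lemma nsum_scale: "nsum I (\<lambda>i. scale c (v i)) = scale c (nsum I v)" if v: "summable_family I v"
proof (rule nseries_eqI)
  fix p
  have s: "summable_family I (\<lambda>i. scale c (v i))"
    by (rule summable_family_dominated[OF v supp_scale])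
  have "coeff (nsum I (\<lambda>i. scale c (v i))) p = (\<Sum>i\<in>{i\<in>I. p \<in> supp (v i)}. coeff (scale c (v i)) p)"
  proof (rule nsum_coeff_superset[OF s])
    show "finite {i\<in>I. p \<in> supp (v i)}" using v by (simp add: summable_family_def)
    show "{i\<in>I. p \<in> supp (scale c (v i))} \<subseteq> {i\<in>I. p \<in> supp (v i)}"
      using supp_scale by blast
  qed blast
  then show "coeff (nsum I (\<lambda>i. scale c (v i))) p = coeff (scale c (nsum I v)) p"
    by (simp add: scale.rep_eq coeff_nsum[OF v] sum_distrib_left)
qed

text \<open>The Cauchy product is strongly bilinear. An exponent is a sum of an element of the union of the
  supports on the left and of one on the right in finitely many ways only, and each of these
  elements lies in finitely many supports.\<close>

lemma
  fixes a :: "'i \<Rightarrow> ('m::po_monoid, 'k::ring_1) nseries"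
  assumes a: "summable_family I a" and b: "summable_family J b"
  shows summable_family_times: "summable_family (I \<times> J) (\<lambda>(i, j). a i * b j)"
    and nsum_times: "nsum (I \<times> J) (\<lambda>(i, j). a i * b j) = nsum I a * nsum J b"
proof -
  let ?S = "\<Union>i\<in>I. supp (a i)" and ?T = "\<Union>j\<in>J. supp (b j)"
  have S: "noetherian ?S" and T: "noetherian ?T"
    using a b unfolding summable_family_def by blast+
  define P where "P m = {(x, y). x + y = m \<and> x \<in> ?S \<and> y \<in> ?T}" for m
  have P: "finite (P m)" for m unfolding P_def by (rule noetherian_finite_fibre[OF S T])
  define F where "F m = (\<Union>(x, y)\<in>P m. {i\<in>I. x \<in> supp (a i)} \<times> {j\<in>J. y \<in> supp (b j)})" for m
  have F: "finite (F m)" for m unfolding F_def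
    using P a b by (intro finite_UN_I) (auto simp: summable_family_def)
  have sup: "supp (a i * b j) \<subseteq> {m. \<exists>x\<in>supp (a i). \<exists>y\<in>supp (b j). m = x + y}" for i j
    by (rule supp_times)
  have sub: "{k\<in>I \<times> J. p \<in> supp (case k of (i, j) \<Rightarrow> a i * b j)} \<subseteq> F p" for p
  proof (intro subsetI; clarify)
    fix i j assume ij: "i \<in> I" "j \<in> J" and "p \<in> supp (a i * b j)"
    then obtain x y where "x \<in> supp (a i)" "y \<in> supp (b j)" "p = x + y" using sup by blast
    with ij show "(i, j) \<in> F p" unfolding F_def P_def by blast
  qed
  have "(\<Union>k\<in>I \<times> J. supp (case k of (i, j) \<Rightarrow> a i * b j)) \<subseteq> {m. \<exists>x\<in>?S. \<exists>y\<in>?T. m = x + y}"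
  proof clarify
    fix m i j assume ij: "i \<in> I" "j \<in> J" and "m \<in> supp (a i * b j)"
    then obtain x y where "x \<in> supp (a i)" "y \<in> supp (b j)" "m = x + y" using sup by blast
    with ij show "\<exists>x\<in>?S. \<exists>y\<in>?T. m = x + y" by blast
  qed
  then have "noetherian (\<Union>k\<in>I \<times> J. supp (case k of (i, j) \<Rightarrow> a i * b j))"
    by (rule noetherian_subset[OF noetherian_sumset[OF S T]])
  then show s: "summable_family (I \<times> J) (\<lambda>(i, j). a i * b j)"
    unfolding summable_family_def using finite_subset[OF sub F] by blast
  show "nsum (I \<times> J) (\<lambda>(i, j). a i * b j) = nsum I a * nsum J b"
  proof (rule nseries_eqI)
    fix p
    define A where "A = (\<Union>(x, y)\<in>P p. {i\<in>I. x \<in> supp (a i)})"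
    define B where "B = (\<Union>(x, y)\<in>P p. {j\<in>J. y \<in> supp (b j)})"
    have AB: "finite A" "finite B" "A \<subseteq> I" "B \<subseteq> J" "F p \<subseteq> A \<times> B"
    proof -
      show "finite A" unfolding A_def
        using P a by (intro finite_UN_I) (auto simp: summable_family_def)
      show "finite B" unfolding B_def
        using P b by (intro finite_UN_I) (auto simp: summable_family_def)
    qed (auto simp: A_def B_def F_def)
    have "coeff (nsum (I \<times> J) (\<lambda>(i, j). a i * b j)) p =
        (\<Sum>k\<in>A \<times> B. coeff (case k of (i, j) \<Rightarrow> a i * b j) p)"
      using AB by (intro nsum_coeff_superset[OF s] subset_trans[OF sub] Sigma_mono) auto
    also have "\<dots> = (\<Sum>k\<in>A \<times> B. \<Sum>z\<in>P p. coeff (a (fst k)) (fst z) * coeff (b (snd k)) (snd z))"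
    proof (rule sum.cong)
      fix k assume k: "k \<in> A \<times> B"
      have "coeff (a (fst k) * b (snd k)) p =
          (\<Sum>(x, y)\<in>P p. coeff (a (fst k)) x * coeff (b (snd k)) y)"
        unfolding P_def by (rule coeff_times_on[OF S T]) (use k AB in auto)
      then show "coeff (case k of (i, j) \<Rightarrow> a i * b j) p =
          (\<Sum>z\<in>P p. coeff (a (fst k)) (fst z) * coeff (b (snd k)) (snd z))"
        by (simp add: split_beta)
    qed simp
    also have "\<dots> = (\<Sum>z\<in>P p. \<Sum>k\<in>A \<times> B. coeff (a (fst k)) (fst z) * coeff (b (snd k)) (snd z))"
      by (rule sum.swap)
    also have "\<dots> = (\<Sum>z\<in>P p. (\<Sum>i\<in>A. coeff (a i) (fst z)) * (\<Sum>j\<in>B. coeff (b j) (snd z)))"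
      by (simp add: sum_product sum.cartesian_product split_beta)
    also have "\<dots> = (\<Sum>z\<in>P p. coeff (nsum I a) (fst z) * coeff (nsum J b) (snd z))"
    proof (rule sum.cong)
      fix z assume z: "z \<in> P p"
      have "coeff (nsum I a) (fst z) = (\<Sum>i\<in>A. coeff (a i) (fst z))"
        by (rule nsum_coeff_superset[OF a AB(1,3)]) (use z in \<open>auto simp: A_def split_beta intro!: bexI[of _ z]\<close>)
      moreover have "coeff (nsum J b) (snd z) = (\<Sum>j\<in>B. coeff (b j) (snd z))"
        by (rule nsum_coeff_superset[OF b AB(2,4)]) (use z in \<open>auto simp: B_def split_beta intro!: bexI[of _ z]\<close>)
      ultimately show "(\<Sum>i\<in>A. coeff (a i) (fst z)) * (\<Sum>j\<in>B. coeff (b j) (snd z)) =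
          coeff (nsum I a) (fst z) * coeff (nsum J b) (snd z)" by simp
    qed simp
    also have "\<dots> = coeff (nsum I a * nsum J b) p"
      using coeff_times_on[OF S T supp_nsum[OF a] supp_nsum[OF b], of p]
      by (simp add: P_def split_beta)
    finally show "coeff (nsum (I \<times> J) (\<lambda>(i, j). a i * b j)) p = coeff (nsum I a * nsum J b) p" .
  qed
qed

section \<open>Paths that increase along a relation\<close>

text \<open>The choice in the minimal bad sequence argument of Nash-Williams: choose the terms one after the
  other, each of least length among those that still allow the chosen initial segment to be
  continued to a bad sequence.\<close>

lemma minimal_bad_sequence:
  fixes P :: "'a \<Rightarrow> 'a \<Rightarrow> bool" and len :: "'a \<Rightarrow> nat" and X :: "'a set"
  defines "bad f \<equiv> (\<forall>n::nat. f n \<in> X) \<and> (\<forall>i j. i < j \<longrightarrow> \<not> P (f i) (f j))"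
  assumes "bad f\<^sub>0"
  obtains f where "bad f"
    and "\<And>g n. bad g \<Longrightarrow> (\<And>i. i < n \<Longrightarrow> g i = f i) \<Longrightarrow> len (f n) \<le> len (g n)"
proof -
  \<comment> \<open>A finite list is extensible if it is an initial segment of a bad sequence.\<close>
  define ext where "ext xs \<longleftrightarrow> (\<exists>g. bad g \<and> (\<forall>i<length xs. g i = xs ! i))" for xs
  have "\<exists>F. \<forall>n. (ext (F n) \<and> length (F n) = n) \<and>
      (\<exists>x. F (Suc n) = F n @ [x] \<and> (\<forall>y. ext (F n @ [y]) \<longrightarrow> len x \<le> len y))"
  proof (rule dependent_nat_choice)
    show "\<exists>xs. ext xs \<and> length xs = 0" using assms(2) unfolding ext_def by auto
  next
    fix xs n assume xs: "ext xs \<and> length xs = n"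
    then obtain g where "bad g" "\<forall>i<length xs. g i = xs ! i" unfolding ext_def by blast
    then have "ext (xs @ [g n])" using xs unfolding ext_def
      by (intro exI[of _ g]) (auto simp: nth_append less_Suc_eq)
    then obtain x where "ext (xs @ [x])" "\<forall>y. ext (xs @ [y]) \<longrightarrow> len x \<le> len y"
      using ex_has_least_nat[of "\<lambda>y. ext (xs @ [y])" "g n" len] by blast
    then show "\<exists>ys. (ext ys \<and> length ys = Suc n) \<and>
        (\<exists>x. ys = xs @ [x] \<and> (\<forall>y. ext (xs @ [y]) \<longrightarrow> len x \<le> len y))"
      using xs by auto
  qed
  then obtain F where F: "\<And>n. ext (F n)" "\<And>n. length (F n) = n"
      "\<And>n. \<exists>x. F (Suc n) = F n @ [x] \<and> (\<forall>y. ext (F n @ [y]) \<longrightarrow> len x \<le> len y)"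
    by blast
  define f where "f n = last (F (Suc n))" for n
  have step: "F (Suc n) = F n @ [f n]" and least: "ext (F n @ [y]) \<Longrightarrow> len (f n) \<le> len y" for n y
    using F(3)[of n] unfolding f_def by auto
  have nth: "F n ! i = f i" if "i < n" for i n
    using that by (induction n) (auto simp: step nth_append F(2) less_Suc_eq)
  have "bad f" unfolding bad_def
  proof (intro conjI allI impI)
    fix n
    obtain g where "bad g" "\<forall>i<Suc n. g i = F (Suc n) ! i" using F(1)[of "Suc n"] F(2) unfolding ext_def by auto
    then have "g n = f n" "bad g" by (auto simp: nth)
    then show "f n \<in> X" unfolding bad_def by metis
  next
    fix i j :: nat assume "i < j"
    obtain g where "bad g" "\<forall>i<Suc j. g i = F (Suc j) ! i" using F(1)[of "Suc j"] F(2) unfolding ext_def by auto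
    then have "g i = f i" "g j = f j" "bad g" using \<open>i < j\<close> by (auto simp: nth)
    then show "\<not> P (f i) (f j)" using \<open>i < j\<close> unfolding bad_def by metis
  qed
  moreover have "len (f n) \<le> len (g n)" if "bad g" "\<And>i. i < n \<Longrightarrow> g i = f i" for g n
  proof (rule least)
    show "ext (F n @ [g n])" unfolding ext_def
      using that F(2) nth by (intro exI[of _ g]) (auto simp: nth_append less_Suc_eq)
  qed
  ultimately show thesis by (rule that)
qed

text \<open>A path from \<open>p\<close> is the list of its labelled steps, the last step at the head, in
  the order in which the letters of a word of composed maps are written.\<close>

fun path_end :: "'w \<Rightarrow> ('t \<times> 'w) list \<Rightarrow> 'w" where
  "path_end p [] = p"
| "path_end p ((t, q) # xs) = q"

fun is_path :: "('t \<Rightarrow> 'w \<Rightarrow> 'w \<Rightarrow> bool) \<Rightarrow> 'w \<Rightarrow> ('t \<times> 'w) list \<Rightarrow> bool" where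
  "is_path R p [] = True"
| "is_path R p ((t, q) # xs) = (R t (path_end p xs) q \<and> is_path R p xs)"

text \<open>Call two paths comparable if they are equal or if the end point of the first is below that of the
  second. If a relation is increasing and sends Noetherian sets to Noetherian sets with finite
  fibres, then no sequence of paths with starting points in a Noetherian set avoids comparable pairs:
  otherwise take a sequence that avoids them and is minimal with respect to the lengths of the
  paths. Shortening its paths by their last step gives
  sequences which do not avoid comparable pairs, by minimality; hence the end points of the shortened
  paths form a Noetherian set. So do the end points of the original paths, which are
  therefore constant along a subsequence. Only finitely many last steps lead to this one point, so
  that infinitely many paths share the last step, and two comparable shortened paths among these
  must be equal. This contradicts the choice of the sequence.\<close>

lemma paths_good:
  fixes R :: "'t \<Rightarrow> 'w::order \<Rightarrow> 'w \<Rightarrow> bool" and S :: "'w set"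
  assumes S: "noetherian S"
    and up: "\<And>t p q. R t p q \<Longrightarrow> p < q"
    and img: "\<And>P. noetherian P \<Longrightarrow> noetherian {q. \<exists>t. \<exists>p\<in>P. R t p q}"
    and fib: "\<And>P q. noetherian P \<Longrightarrow> finite {(t, p). p \<in> P \<and> R t p q}"
    and f0: "\<And>n. fst (f\<^sub>0 n) \<in> S \<and> is_path R (fst (f\<^sub>0 n)) (snd (f\<^sub>0 n))"
  shows "\<exists>i j. i < (j::nat) \<and> (f\<^sub>0 i = f\<^sub>0 j \<or>
    path_end (fst (f\<^sub>0 i)) (snd (f\<^sub>0 i)) < path_end (fst (f\<^sub>0 j)) (snd (f\<^sub>0 j)))"
proof (rule ccontr)
  define X where "X = {(p, xs). p \<in> S \<and> is_path R p xs}"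
  define e :: "'w \<times> ('t \<times> 'w) list \<Rightarrow> 'w" where "e x = path_end (fst x) (snd x)" for x
  define le where "le x y \<longleftrightarrow> x = y \<or> e x < e y" for x y
  define bad where "bad f \<longleftrightarrow> (\<forall>n::nat. f n \<in> X) \<and> (\<forall>i j. i < j \<longrightarrow> \<not> le (f i) (f j))" for f
  assume "\<not> ?thesis"
  then have "bad f\<^sub>0" unfolding bad_def le_def e_def X_def using f0 by (auto simp: split_beta)
  then obtain f where f: "bad f"
    and least: "\<And>g n. bad g \<Longrightarrow> (\<And>i. i < n \<Longrightarrow> g i = f i) \<Longrightarrow> length (snd (f n)) \<le> length (snd (g n))"
    unfolding bad_def using minimal_bad_sequence[where X = X and f\<^sub>0 = f\<^sub>0 and P = le and len = "\<lambda>x. length (snd x)"] by blast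
  have fX: "f n \<in> X" for n using f unfolding bad_def by blast
  have fbad: "\<not> le (f i) (f j)" if "i < j" for i j using f that unfolding bad_def by blast
  \<comment> \<open>Paths of length zero are points of the Noetherian set, so a bad sequence contains only finitely many.\<close>
  let ?Z = "{n. snd (f n) = []}"
  have "finite ?Z"
  proof (rule ccontr)
    assume Z: "infinite ?Z"
    let ?r = "enumerate ?Z"
    have r: "snd (f (?r n)) = []" for n using enumerate_in_set[OF Z, of n] by simp
    obtain i j where ij: "i < j" "fst (f (?r i)) \<le> fst (f (?r j))"
      by (rule noetherian_good[OF S, of "\<lambda>n. fst (f (?r n))"]) (use fX in \<open>auto simp: X_def split_beta\<close>)
    have "le (f (?r i)) (f (?r j))"
      using ij(2) r[of i] r[of j] unfolding le_def e_def by (auto simp: prod_eq_iff order_le_less)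
    then show False using fbad strict_monoD[OF strict_mono_enumerate[OF Z] ij(1)] by blast
  qed
  then obtain N where "\<forall>n\<in>?Z. n < N" unfolding finite_nat_set_iff_bounded by blast
  then have nonempty: "snd (f (N + n)) \<noteq> []" for n by force
  \<comment> \<open>All paths from index \<open>N\<close> on have a last step; \<open>h n\<close> is what precedes it.\<close>
  define h where "h n = (fst (f (N + n)), tl (snd (f (N + n))))" for n
  define t where "t n = fst (hd (snd (f (N + n))))" for n
  have shape: "f (N + n) = (fst (h n), (t n, e (f (N + n))) # snd (h n))" for n
    using nonempty[of n] by (cases "f (N + n)"; cases "snd (f (N + n))") (auto simp: h_def t_def e_def)
  have hX: "h n \<in> X" and hR: "R (t n) (e (h n)) (e (f (N + n)))" for n
    using fX[of "N + n"] unfolding X_def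
    by (subst (asm) shape, auto simp: e_def split_beta)+
  have hlt: "e (h n) < e (f (N + n))" for n using up[OF hR] .
  have hlen: "length (snd (h n)) < length (snd (f (N + n)))" for n
    by (subst shape) simp
  have hgood: "\<exists>i j. i < j \<and> le (g i) (g j)" if "\<And>n. g n \<in> range h" for g :: "nat \<Rightarrow> _"
  proof (rule ccontr)
    assume no: "\<not> ?thesis"
    from that have "\<forall>n. \<exists>m. g n = h m" by blast
    then obtain m where m: "\<And>n. g n = h (m n)" by metis
    obtain k where k: "\<And>j. m k \<le> m j"
      using ex_has_least_nat[of "\<lambda>_. True" undefined m] by blast
    \<comment> \<open>Splice the shortened paths, from the one of least index \<open>m k\<close> on, to the paths that come
      before it in the minimal bad sequence.\<close>
    define g' where "g' i = (if i < N + m k then f i else g (k + (i - (N + m k))))" for i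
    have "bad g'" unfolding bad_def
    proof (intro conjI allI impI)
      fix n show "g' n \<in> X" using fX hX m by (simp add: g'_def)
    next
      fix i j :: nat assume ij: "i < j"
      consider "j < N + m k" | "i < N + m k" "N + m k \<le> j" | "N + m k \<le> i" by linarith
      then show "\<not> le (g' i) (g' j)"
      proof cases
        case 1 then show ?thesis using fbad ij by (simp add: g'_def)
      next
        case 2
        define l where "l = m (k + (j - (N + m k)))"
        have "i < N + l" using 2 k[of "k + (j - (N + m k))"] by (simp add: l_def)
        then have "\<not> le (f i) (f (N + l))" by (rule fbad)
        then have "\<not> le (f i) (h l)" using hlt[of l] unfolding le_def by auto
        then show ?thesis using 2 m by (simp add: g'_def l_def)
      next
        case 3 then show ?thesis using no ij by (auto simp: g'_def)
      qed
    qed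
    then have "length (snd (f (N + m k))) \<le> length (snd (g' (N + m k)))"
      by (rule least) (simp add: g'_def)
    then show False using hlen[of "m k"] m by (simp add: g'_def)
  qed
  \<comment> \<open>The end points of the shortened paths.\<close>
  define E where "E = e ` range h"
  have E: "noetherian E"
  proof (rule noetherianI)
    fix c :: "nat \<Rightarrow> 'w" assume "\<And>n. c n \<in> E"
    then have "\<forall>n. \<exists>m. m \<in> range h \<and> c n = e m" unfolding E_def by blast
    then obtain g where g: "\<And>n. g n \<in> range h" "\<And>n. c n = e (g n)" by metis
    then show "\<exists>i j. i < j \<and> c i \<le> c j" using hgood[of g] unfolding le_def by (metis order.refl less_imp_le)
  qed
  have "\<And>n. e (f (N + n)) \<in> {q. \<exists>t. \<exists>p\<in>E. R t p q}" using hR unfolding E_def by blast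
  from noetherian_subseq[OF img[OF E], of "\<lambda>n. e (f (N + n))", OF this]
  obtain r :: "nat \<Rightarrow> nat" where r: "strict_mono r" "\<And>i j. i \<le> j \<Longrightarrow> e (f (N + r i)) \<le> e (f (N + r j))"
    by blast
  \<comment> \<open>A weakly increasing sequence of end points without comparable pairs is constant.\<close>
  define q where "q = e (f (N + r 0))"
  have eq: "e (f (N + r i)) = q" for i
  proof (cases "i = 0")
    case False
    then have "\<not> le (f (N + r 0)) (f (N + r i))"
      by (intro fbad) (use strict_monoD[OF r(1), of 0 i] in simp)
    moreover have "q \<le> e (f (N + r i))" unfolding q_def by (rule r(2)) simp
    ultimately show ?thesis unfolding le_def q_def by (metis le_less)
  qed (simp add: q_def)
  have "finite (range (\<lambda>i. (t (r i), e (h (r i)))))"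
  proof (rule finite_subset[OF _ fib[OF E]])
    show "range (\<lambda>i. (t (r i), e (h (r i)))) \<subseteq> {(t, p). p \<in> E \<and> R t p q}"
    proof
      fix z assume "z \<in> range (\<lambda>i. (t (r i), e (h (r i))))"
      then obtain i where "z = (t (r i), e (h (r i)))" by blast
      moreover have "R (t (r i)) (e (h (r i))) q" using hR[of "r i"] eq[of i] by simp
      ultimately show "z \<in> {(t, p). p \<in> E \<and> R t p q}" by (simp add: E_def)
    qed
  qed
  then obtain i\<^sub>0 where inf: "infinite {i. (t (r i), e (h (r i))) = (t (r i\<^sub>0), e (h (r i\<^sub>0)))}"
    using pigeonhole_infinite[of UNIV "\<lambda>i. (t (r i), e (h (r i)))"] by auto
  define s where "s = enumerate {i. (t (r i), e (h (r i))) = (t (r i\<^sub>0), e (h (r i\<^sub>0)))}"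
  have s: "strict_mono s" unfolding s_def by (rule strict_mono_enumerate[OF inf])
  have const: "t (r (s i)) = t (r i\<^sub>0)" "e (h (r (s i))) = e (h (r i\<^sub>0))" for i
    using enumerate_in_set[OF inf, of i] by (auto simp: s_def)
  obtain i j where ij: "i < j" "le (h (r (s i))) (h (r (s j)))"
    using hgood[of "\<lambda>i. h (r (s i))"] by blast
  have "h (r (s i)) = h (r (s j))"
    using ij(2) const(2)[of i] const(2)[of j] unfolding le_def by simp
  then have "f (N + r (s i)) = f (N + r (s j))"
    using shape[of "r (s i)"] shape[of "r (s j)"] by (simp add: const(1) eq)
  moreover have "N + r (s i) < N + r (s j)"
    using strict_monoD[OF r(1)] strict_monoD[OF s ij(1)] by simp
  ultimately show False using fbad unfolding le_def by blast
qed

section \<open>Strongly linear and contracting maps\<close>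

definition Lin_prec :: "(('w::order, 'k::field) nseries \<Rightarrow> ('w, 'k) nseries) set" where
  "Lin_prec = {\<phi>. contracting \<phi> \<and> strongly_linear \<phi>}"

interpretation scale: vector_space scale
  by (rule vector_space_scale)

lemma linear_scale_iff:
  "Vector_Spaces.linear scale scale \<phi> \<longleftrightarrow>
    (\<forall>v w. \<phi> (v + w) = \<phi> v + \<phi> w) \<and> (\<forall>c v. \<phi> (scale c v) = scale c (\<phi> v))"
  by (simp add: Vector_Spaces.linear_def module_hom_def module_hom_axioms_def
      vector_space_scale scale.module_axioms)

lemma strongly_linear_add: "strongly_linear \<phi> \<Longrightarrow> \<phi> (v + w) = \<phi> v + \<phi> w"
  and strongly_linear_scale: "strongly_linear \<phi> \<Longrightarrow> \<phi> (scale c v) = scale c (\<phi> v)"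
  by (simp_all add: strongly_linear_def linear_scale_iff)

lemma strongly_linear_zero: "strongly_linear \<phi> \<Longrightarrow> \<phi> 0 = 0"
  using strongly_linear_add[of \<phi> 0 0] by simp

lemma strongly_linearI:
  fixes \<phi> :: "('w::order, 'k::field) nseries \<Rightarrow> ('w, 'k) nseries"
  assumes "\<And>v w. \<phi> (v + w) = \<phi> v + \<phi> w" "\<And>c v. \<phi> (scale c v) = scale c (\<phi> v)"
    and "\<And>(I :: (nat \<times> 'w) set) v. summable_family I v \<Longrightarrow>
      summable_family I (\<lambda>i. \<phi> (v i)) \<and> nsum I (\<lambda>i. \<phi> (v i)) = \<phi> (nsum I v)"
  shows "strongly_linear \<phi>"
  using assms unfolding strongly_linear_def linear_scale_iff by blast

lemma strongly_linear_id: "strongly_linear (\<lambda>v. v)"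
  by (rule strongly_linearI) auto

lemma strongly_linear_comp:
  assumes \<phi>: "strongly_linear \<phi>" and \<psi>: "strongly_linear \<psi>"
  shows "strongly_linear (\<lambda>v. \<phi> (\<psi> v))"
proof (rule strongly_linearI)
  fix I :: "(nat \<times> 'a) set" and v :: "nat \<times> 'a \<Rightarrow> ('a, 'b) nseries"
  assume v: "summable_family I v"
  note s = strongly_linear_summable[OF \<psi> v]
  show "summable_family I (\<lambda>i. \<phi> (\<psi> (v i))) \<and>
      nsum I (\<lambda>i. \<phi> (\<psi> (v i))) = \<phi> (\<psi> (nsum I v))"
    using strongly_linear_summable[OF \<phi> s] strongly_linear_nsum[OF \<phi> s]
    by (simp add: strongly_linear_nsum[OF \<psi> v])
qed (simp_all add: assms strongly_linear_add strongly_linear_scale)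

lemma strongly_linear_funpow: "strongly_linear \<phi> \<Longrightarrow> strongly_linear (\<phi> ^^ n)"
  by (induction n) (auto simp: o_def id_def intro: strongly_linear_id strongly_linear_comp)

lemma
  fixes v w :: "'i \<Rightarrow> ('w::order, 'k::field) nseries"
  assumes v: "summable_family I v" and w: "summable_family I w"
  shows summable_family_diff: "summable_family I (\<lambda>i. v i - w i)"
    and nsum_diff: "nsum I (\<lambda>i. v i - w i) = nsum I v - nsum I w"
proof -
  have *: "v i - w i = v i + scale (- 1) (w i)" for i by simp
  have s: "summable_family I (\<lambda>i. scale (- 1) (w i))"
    by (rule summable_family_dominated[OF w supp_scale])
  show "summable_family I (\<lambda>i. v i - w i)" "nsum I (\<lambda>i. v i - w i) = nsum I v - nsum I w"
    unfolding * using summable_family_add[OF v s] nsum_add[OF v s] nsum_scale[OF w, of "- 1"] by simp_all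
qed

lemma strongly_linear_minus:
  assumes "strongly_linear \<phi>" "strongly_linear \<psi>"
  shows "strongly_linear (\<lambda>v. \<phi> v - \<psi> v)"
proof (rule strongly_linearI)
  fix I :: "(nat \<times> 'a) set" and v :: "nat \<times> 'a \<Rightarrow> ('a, 'b) nseries"
  assume v: "summable_family I v"
  note s = strongly_linear_summable[OF _ v]
  show "summable_family I (\<lambda>i. \<phi> (v i) - \<psi> (v i)) \<and>
      nsum I (\<lambda>i. \<phi> (v i) - \<psi> (v i)) = \<phi> (nsum I v) - \<psi> (nsum I v)"
    using summable_family_diff[OF s s] nsum_diff[OF s s] assms
    by (simp add: strongly_linear_nsum[OF _ v])
qed (use assms in \<open>auto simp: strongly_linear_add strongly_linear_scale scale.scale_right_diff_distrib\<close>)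

lemma contracting_supp:
  assumes "contracting \<phi>" "q \<in> supp (\<phi> v)"
  obtains p where "p \<in> supp v" "p < q"
proof -
  have "\<phi> 0 + \<phi> 0 = \<phi> 0" using assms(1) unfolding contracting_def linear_scale_iff
    by (metis add_0)
  then have "v \<noteq> 0" using assms(2) by (auto simp: supp_zero)
  then show thesis using assms that unfolding contracting_def prec_def by blast
qed

lemma contractingI:
  assumes "strongly_linear \<phi>" "\<And>v q. q \<in> supp (\<phi> v) \<Longrightarrow> \<exists>p\<in>supp v. p < q"
  shows "contracting \<phi>"
  using assms unfolding contracting_def prec_def strongly_linear_def by blast

lift_definition delta :: "'w::order \<Rightarrow> ('w, 'k::field) nseries" is "\<lambda>p q. if q = p then 1 else 0"
  by (simp add: noetherian_finite)

lemma supp_delta: "supp (delta p) = {p}"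
  by (auto simp: supp_def delta.rep_eq)

lemma summable_family_delta: "noetherian S \<Longrightarrow> summable_family S delta"
  by (simp add: summable_family_def supp_delta)

lemma nseries_eq_nsum_delta: "v = nsum (supp v) (\<lambda>p. scale (coeff v p) (delta p))"
proof (rule nseries_eqI)
  fix q
  have s: "summable_family (supp v) (\<lambda>p. scale (coeff v p) (delta p))"
    using summable_family_delta[OF noetherian_supp] supp_scale by (rule summable_family_dominated)
  have "coeff (nsum (supp v) (\<lambda>p. scale (coeff v p) (delta p))) q =
      (\<Sum>p\<in>supp v \<inter> {q}. coeff (scale (coeff v p) (delta p)) q)"
  proof (rule nsum_coeff_superset[OF s])
    show "{p \<in> supp v. q \<in> supp (scale (coeff v p) (delta p))} \<subseteq> supp v \<inter> {q}"
      by (auto simp: supp_def scale.rep_eq delta.rep_eq split: if_splits)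
  qed auto
  also have "\<dots> = coeff v q"
    by (cases "q \<in> supp v") (auto simp: scale.rep_eq delta.rep_eq not_in_supp)
  finally show "coeff v q = coeff (nsum (supp v) (\<lambda>p. scale (coeff v p) (delta p))) q" by simp
qed

text \<open>A strongly linear map is determined by its values on monomials, and an exponent of a value
  comes from an exponent of the argument. This makes words of maps accessible to paths.\<close>

lemma strongly_linear_supp:
  assumes \<phi>: "strongly_linear \<phi>" and q: "q \<in> supp (\<phi> v)"
  obtains p where "p \<in> supp v" "q \<in> supp (\<phi> (delta p))"
proof -
  have s: "summable_family (supp v) (\<lambda>p. scale (coeff v p) (delta p))"
    using summable_family_delta[OF noetherian_supp] supp_scale by (rule summable_family_dominated)
  have "\<phi> v = nsum (supp v) (\<lambda>p. \<phi> (scale (coeff v p) (delta p)))"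
    using strongly_linear_nsum[OF \<phi> s] nseries_eq_nsum_delta[of v] by simp
  then have "supp (\<phi> v) \<subseteq> (\<Union>p\<in>supp v. supp (\<phi> (scale (coeff v p) (delta p))))"
    using supp_nsum[OF strongly_linear_summable[OF \<phi> s]] by simp
  also have "\<dots> \<subseteq> (\<Union>p\<in>supp v. supp (\<phi> (delta p)))"
    using supp_scale[of _ "\<phi> (delta _)"] by (auto simp: strongly_linear_scale[OF \<phi>])
  finally show thesis using q that by blast
qed

section \<open>Summability of all words in two contracting maps\<close>

lemma word_comp_Nil: "word_comp \<phi>0 \<phi>1 [] = id"
  and word_comp_Cons: "word_comp \<phi>0 \<phi>1 (t # \<theta>) = (if t then \<phi>1 else \<phi>0) \<circ> word_comp \<phi>0 \<phi>1 \<theta>"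
  by (simp_all add: word_comp_def)

lemma word_comp_append: "word_comp \<phi>0 \<phi>1 (\<alpha> @ \<beta>) = word_comp \<phi>0 \<phi>1 \<alpha> \<circ> word_comp \<phi>0 \<phi>1 \<beta>"
  by (induction \<alpha>) (simp_all add: word_comp_Nil word_comp_Cons o_assoc)

lemma word_comp_replicate:
  "word_comp \<phi>0 \<phi>1 (replicate n t) = (if t then \<phi>1 else \<phi>0) ^^ n"
  by (induction n) (simp_all add: word_comp_Nil word_comp_Cons)

text \<open>An exponent \<open>q\<close> of \<open>word_comp \<phi>0 \<phi>1 \<theta> (v i)\<close> is reached from an exponent of
  \<open>v i\<close> by a path with labels \<open>\<theta>\<close>, where a step labelled with a map leads from \<open>p\<close> to the
  exponents of its value at the monomial \<open>delta p\<close>. Steps increase because the maps are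
  contracting, and Noetherian sets have Noetherian images with finite fibres because the maps are
  strongly linear. So \<open>paths_good\<close> applies: it shows that the end points form a Noetherian set
  and that only finitely many paths lead to a given end point; as each starting point is an exponent
  of finitely many \<open>v i\<close>, only finitely many pairs \<open>(\<theta>, i)\<close> belong to these paths.\<close>

lemma summable_family_words:
  assumes "\<phi>0 \<in> Lin_prec" "\<phi>1 \<in> Lin_prec" and v: "summable_family I v"
  shows "summable_family (UNIV \<times> I) (\<lambda>(\<theta>, i). word_comp \<phi>0 \<phi>1 \<theta> (v i))"
proof -
  define \<phi> where "\<phi> t = (if t then \<phi>1 else \<phi>0)" for t
  have sl: "strongly_linear (\<phi> t)" and con: "contracting (\<phi> t)" for t
    using assms by (auto simp: \<phi>_def Lin_prec_def)
  define R where "R t p q \<longleftrightarrow> q \<in> supp (\<phi> t (delta p))" for t p q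
  define S where "S = (\<Union>i\<in>I. supp (v i))"
  have S: "noetherian S" using v unfolding S_def summable_family_def by blast
  have up: "p < q" if "R t p q" for t p q
    using that contracting_supp[OF con] unfolding R_def by (metis singletonD supp_delta)
  have sum: "summable_family P (\<lambda>p. \<phi> t (delta p))" if "noetherian P" for P t
    by (rule strongly_linear_summable[OF sl summable_family_delta[OF that]])
  have img: "noetherian {q. \<exists>t. \<exists>p\<in>P. R t p q}" if "noetherian P" for P
  proof -
    have "{q. \<exists>t. \<exists>p\<in>P. R t p q} =
        (\<Union>p\<in>P. supp (\<phi> True (delta p))) \<union> (\<Union>p\<in>P. supp (\<phi> False (delta p)))"
      unfolding R_def by (auto; metis (full_types))
    then show ?thesis using sum[OF that] unfolding summable_family_def by (simp add: noetherian_Un)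
  qed
  have fib: "finite {(t, p). p \<in> P \<and> R t p q}" if "noetherian P" for P q
  proof -
    have "{(t, p). p \<in> P \<and> R t p q} = (\<Union>t. Pair t ` {p\<in>P. q \<in> supp (\<phi> t (delta p))})"
      unfolding R_def by auto
    then show ?thesis using sum[OF that] unfolding summable_family_def by simp
  qed
  have good: "\<exists>i j. i < j \<and> (f i = f j \<or>
      path_end (fst (f i)) (snd (f i)) < path_end (fst (f j)) (snd (f j)))"
    if "\<And>n. fst (f n) \<in> S \<and> is_path R (fst (f n)) (snd (f n))" for f :: "nat \<Rightarrow> _"
    by (rule paths_good[where S = S and R = R, OF S up img fib that])
  have path: "\<exists>p xs. p \<in> supp w \<and> is_path R p xs \<and> map fst xs = \<theta> \<and> path_end p xs = q"
    if "q \<in> supp (word_comp \<phi>0 \<phi>1 \<theta> w)" for q \<theta> w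
    using that
  proof (induction \<theta> arbitrary: q)
    case Nil
    then show ?case by (intro exI[of _ q] exI[of _ "[]"]) (simp add: word_comp_Nil)
  next
    case (Cons t \<theta>)
    then have "q \<in> supp (\<phi> t (word_comp \<phi>0 \<phi>1 \<theta> w))" by (simp add: word_comp_Cons \<phi>_def)
    then obtain p' where p': "p' \<in> supp (word_comp \<phi>0 \<phi>1 \<theta> w)" "R t p' q"
      using strongly_linear_supp[OF sl] unfolding R_def by metis
    from Cons.IH[OF p'(1)] obtain p xs where "p \<in> supp w" "is_path R p xs" "map fst xs = \<theta>" "path_end p xs = p'"
      by blast
    then show ?case using p'(2) by (intro exI[of _ p] exI[of _ "(t, q) # xs"]) simp
  qed
  have path_S: "\<exists>p xs. p \<in> supp (v i) \<and> p \<in> S \<and> is_path R p xs \<and> map fst xs = \<theta> \<and> path_end p xs = q"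
    if "i \<in> I" "q \<in> supp (word_comp \<phi>0 \<phi>1 \<theta> (v i))" for i \<theta> q
    using path[OF that(2)] that(1) unfolding S_def by blast
  show ?thesis unfolding summable_family_def
  proof
    show "noetherian (\<Union>z\<in>UNIV \<times> I. supp (case z of (\<theta>, i) \<Rightarrow> word_comp \<phi>0 \<phi>1 \<theta> (v i)))"
    proof (rule noetherianI)
      fix c :: "nat \<Rightarrow> 'a"
      assume c: "\<And>n. c n \<in> (\<Union>z\<in>UNIV \<times> I. supp (case z of (\<theta>, i) \<Rightarrow> word_comp \<phi>0 \<phi>1 \<theta> (v i)))"
      have "\<exists>x. (fst x \<in> S \<and> is_path R (fst x) (snd x)) \<and> path_end (fst x) (snd x) = c n" for n
      proof -
        obtain \<theta> i where "i \<in> I" "c n \<in> supp (word_comp \<phi>0 \<phi>1 \<theta> (v i))"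
          using c[of n] by auto
        with path_S obtain p xs where "p \<in> S" "is_path R p xs" "path_end p xs = c n"
          by blast
        then show ?thesis by (intro exI[of _ "(p, xs)"]) simp
      qed
      then obtain f where f: "\<And>n. fst (f n) \<in> S \<and> is_path R (fst (f n)) (snd (f n))"
          "\<And>n. path_end (fst (f n)) (snd (f n)) = c n" by metis
      show "\<exists>i j. i < j \<and> c i \<le> c j"
      proof -
        have "\<exists>i j. i < j \<and> (f i = f j \<or>
            path_end (fst (f i)) (snd (f i)) < path_end (fst (f j)) (snd (f j)))"
          by (rule good) (rule f(1))
        then obtain i j where "i < j" "f i = f j \<or> c i < c j" unfolding f(2) by blast
        then have "c i \<le> c j" using f(2)[of i] f(2)[of j] by auto
        with \<open>i < j\<close> show ?thesis by blast
      qed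
    qed
    show "\<forall>q. finite {z\<in>UNIV \<times> I. q \<in> supp (case z of (\<theta>, i) \<Rightarrow> word_comp \<phi>0 \<phi>1 \<theta> (v i))}"
    proof
      fix q
      define Y where "Y = {x. fst x \<in> S \<and> is_path R (fst x) (snd x) \<and> path_end (fst x) (snd x) = q}"
      have "finite Y"
      proof (rule ccontr)
        assume "infinite Y"
        then obtain f :: "nat \<Rightarrow> _" where f: "inj f" "range f \<subseteq> Y"
          using infinite_countable_subset by blast
        have fY: "f n \<in> Y" for n using f(2) by blast
        then have "fst (f n) \<in> S \<and> is_path R (fst (f n)) (snd (f n))" for n
          by (simp add: Y_def)
        then have "\<exists>i j. i < j \<and> (f i = f j \<or>
            path_end (fst (f i)) (snd (f i)) < path_end (fst (f j)) (snd (f j)))"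
          by (rule good)
        moreover have "path_end (fst (f n)) (snd (f n)) = q" for n
          using fY[of n] by (simp add: Y_def)
        ultimately show False using f(1) by (auto dest: injD)
      qed
      then have "finite (\<Union>x\<in>Y. {map fst (snd x)} \<times> {i\<in>I. fst x \<in> supp (v i)})"
        using v unfolding summable_family_def by blast
      moreover have "{z\<in>UNIV \<times> I. q \<in> supp (case z of (\<theta>, i) \<Rightarrow> word_comp \<phi>0 \<phi>1 \<theta> (v i))} \<subseteq>
          (\<Union>x\<in>Y. {map fst (snd x)} \<times> {i\<in>I. fst x \<in> supp (v i)})"
      proof (intro subsetI; clarify)
        fix \<theta> i assume "i \<in> I" "q \<in> supp (word_comp \<phi>0 \<phi>1 \<theta> (v i))"
        with path_S obtain p xs where "p \<in> supp (v i)" "p \<in> S" "is_path R p xs" "map fst xs = \<theta>" "path_end p xs = q"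
          by blast
        then have "(p, xs) \<in> Y" "(\<theta>, i) \<in> {map fst (snd (p, xs))} \<times> {i\<in>I. fst (p, xs) \<in> supp (v i)}"
          using \<open>i \<in> I\<close> unfolding Y_def by auto
        then show "(\<theta>, i) \<in> (\<Union>x\<in>Y. {map fst (snd x)} \<times> {i\<in>I. fst x \<in> supp (v i)})" by blast
      qed
      ultimately show "finite {z\<in>UNIV \<times> I. q \<in> supp (case z of (\<theta>, i) \<Rightarrow> word_comp \<phi>0 \<phi>1 \<theta> (v i))}"
        using finite_subset by blast
    qed
  qed
qed

section \<open>Power series in a contracting map\<close>

text \<open>Substitution of a contracting strongly linear map into a formal power series. It turns identities
  between power series, such as those for exponential and logarithm, into identities between maps.\<close>

definition fps_eval :: "(('w::order, 'k::field) nseries \<Rightarrow> ('w, 'k) nseries) \<Rightarrow> 'k fps \<Rightarrow>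
    ('w, 'k) nseries \<Rightarrow> ('w, 'k) nseries" where
  "fps_eval \<psi> f v = nsum UNIV (\<lambda>n. scale (fps_nth f n) ((\<psi> ^^ n) v))"

lemma Lin_prec_strongly_linear: "\<psi> \<in> Lin_prec \<Longrightarrow> strongly_linear \<psi>"
  and Lin_prec_contracting: "\<psi> \<in> Lin_prec \<Longrightarrow> contracting \<psi>"
  by (simp_all add: Lin_prec_def)

lemma summable_family_funpow:
  assumes \<psi>: "\<psi> \<in> Lin_prec" and v: "summable_family I v"
  shows "summable_family (UNIV \<times> I) (\<lambda>(n, i). (\<psi> ^^ n) (v i))"
proof (rule summable_family_pullback[OF summable_family_words[OF \<psi> \<psi> v],
      where h = "\<lambda>(n, i). (replicate n False, i)"])
  show "finite {x \<in> UNIV \<times> I. (case x of (n, i) \<Rightarrow> (\<psi> ^^ n) (v i)) \<noteq> 0 \<and>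
      (case x of (n, i) \<Rightarrow> (replicate n False, i)) = z}" for z
    by (rule finite_subset[of _ "{(length (fst z), snd z)}"]) auto
qed (auto simp: word_comp_replicate)

lemma summable_family_funpow_single:
  assumes \<psi>: "\<psi> \<in> Lin_prec"
  shows "summable_family UNIV (\<lambda>n. (\<psi> ^^ n) v)"
proof (rule summable_family_pullback[OF summable_family_funpow[OF \<psi>], where h = "\<lambda>n. (n, ())"])
  show "summable_family {()} (\<lambda>_. v)" by (rule summable_family_finite) simp
  show "finite {i \<in> UNIV. (\<psi> ^^ i) v \<noteq> 0 \<and> (i, ()) = j}" for j
    by (rule finite_subset[of _ "{fst j}"]) auto
qed auto

lemma summable_family_fps:
  "\<psi> \<in> Lin_prec \<Longrightarrow> summable_family UNIV (\<lambda>n. scale (fps_nth f n) ((\<psi> ^^ n) v))"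
  by (rule summable_family_dominated[OF summable_family_funpow_single supp_scale])

lemma strongly_linear_fps_eval:
  assumes \<psi>: "\<psi> \<in> Lin_prec"
  shows "strongly_linear (fps_eval \<psi> f)"
proof (rule strongly_linearI)
  note sl = strongly_linear_funpow[OF Lin_prec_strongly_linear[OF \<psi>]]
  show "fps_eval \<psi> f (v + w) = fps_eval \<psi> f v + fps_eval \<psi> f w" for v w
    unfolding fps_eval_def
    by (simp add: strongly_linear_add[OF sl] scale.scale_right_distrib
        nsum_add[OF summable_family_fps[OF \<psi>] summable_family_fps[OF \<psi>]])
  show "fps_eval \<psi> f (scale c v) = scale c (fps_eval \<psi> f v)" for c v
    unfolding fps_eval_def nsum_scale[OF summable_family_fps[OF \<psi>], symmetric]
    by (rule nsum_cong) (simp add: strongly_linear_scale[OF sl] mult.commute)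
  fix I :: "(nat \<times> 'a) set" and v :: "nat \<times> 'a \<Rightarrow> ('a, 'b) nseries"
  assume v: "summable_family I v"
  have s: "summable_family (UNIV \<times> I) (\<lambda>(n, i). scale (fps_nth f n) ((\<psi> ^^ n) (v i)))"
    by (rule summable_family_dominated[OF summable_family_funpow[OF \<psi> v]]) (use supp_scale in auto)
  have s': "summable_family (I \<times> UNIV) (\<lambda>(i, n). scale (fps_nth f n) ((\<psi> ^^ n) (v i)))"
    using summable_family_swap[OF s] by simp
  show "summable_family I (\<lambda>i. fps_eval \<psi> f (v i)) \<and>
      nsum I (\<lambda>i. fps_eval \<psi> f (v i)) = fps_eval \<psi> f (nsum I v)"
  proof
    show "summable_family I (\<lambda>i. fps_eval \<psi> f (v i))"
      using summable_family_iterated[OF s'] by (simp add: fps_eval_def)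
    have "nsum I (\<lambda>i. fps_eval \<psi> f (v i)) =
        nsum UNIV (\<lambda>n. nsum I (\<lambda>i. scale (fps_nth f n) ((\<psi> ^^ n) (v i))))"
      using nsum_swap[OF s] by (simp add: fps_eval_def)
    also have "\<dots> = fps_eval \<psi> f (nsum I v)" unfolding fps_eval_def
      by (rule nsum_cong)
        (simp add: nsum_scale strongly_linear_summable[OF sl v] strongly_linear_nsum[OF sl v])
    finally show "nsum I (\<lambda>i. fps_eval \<psi> f (v i)) = fps_eval \<psi> f (nsum I v)" .
  qed
qed

lemma fps_eval_monomial:
  assumes \<psi>: "\<psi> \<in> Lin_prec" and "\<And>n. n \<noteq> m \<Longrightarrow> fps_nth f n = 0"
  shows "fps_eval \<psi> f v = scale (fps_nth f m) ((\<psi> ^^ m) v)"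
proof -
  have "nsum {m} (\<lambda>n. scale (fps_nth f n) ((\<psi> ^^ n) v)) =
      nsum UNIV (\<lambda>n. scale (fps_nth f n) ((\<psi> ^^ n) v))"
    using nsum_reindex(2)[of "{m}" UNIV "\<lambda>n. n" "\<lambda>n. scale (fps_nth f n) ((\<psi> ^^ n) v)"] assms(2)
    by simp
  then show ?thesis by (simp add: fps_eval_def nsum_finite)
qed

lemma fps_eval_1: "\<psi> \<in> Lin_prec \<Longrightarrow> fps_eval \<psi> 1 v = v"
  by (subst fps_eval_monomial[of _ 0]) auto

lemma fps_eval_X: "\<psi> \<in> Lin_prec \<Longrightarrow> fps_eval \<psi> fps_X v = \<psi> v"
  by (subst fps_eval_monomial[of _ 1]) auto

lemma fps_eval_add:
  assumes \<psi>: "\<psi> \<in> Lin_prec"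
  shows "fps_eval \<psi> (f + g) v = fps_eval \<psi> f v + fps_eval \<psi> g v"
  unfolding fps_eval_def
  by (simp add: scale.scale_left_distrib
      nsum_add[OF summable_family_fps[OF \<psi>] summable_family_fps[OF \<psi>]])

lemma fps_eval_diff:
  assumes \<psi>: "\<psi> \<in> Lin_prec"
  shows "fps_eval \<psi> (f - g) v = fps_eval \<psi> f v - fps_eval \<psi> g v"
  using fps_eval_add[OF \<psi>, of "f - g" g v] by simp

text \<open>The double sum of all \<open>f\<^sub>n g\<^sub>m \<psi>\<^sup>n\<^sup>+\<^sup>m v\<close>, summed by rows and by \<open>n + m\<close>.\<close>

lemma fps_eval_mult:
  assumes \<psi>: "\<psi> \<in> Lin_prec"
  shows "fps_eval \<psi> (f * g) v = fps_eval \<psi> f (fps_eval \<psi> g v)"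
proof -
  note sl = strongly_linear_funpow[OF Lin_prec_strongly_linear[OF \<psi>]]
  define u where "u = (\<lambda>(m, n). scale (fps_nth f n * fps_nth g m) ((\<psi> ^^ (n + m)) v))"
  have u: "summable_family (UNIV \<times> UNIV) u"
  proof (rule summable_family_pullback[OF summable_family_funpow_single[OF \<psi>, of v],
        where h = "\<lambda>(m, n). n + m"])
    show "finite {i \<in> UNIV \<times> UNIV. u i \<noteq> 0 \<and> (case i of (m, n) \<Rightarrow> n + m) = j}" for j
      by (rule finite_subset[of _ "{..j} \<times> {..j}"]) auto
  qed (use supp_scale in \<open>auto simp: u_def\<close>)
  have "fps_eval \<psi> f (fps_eval \<psi> g v) =
      nsum UNIV (\<lambda>m. fps_eval \<psi> f (scale (fps_nth g m) ((\<psi> ^^ m) v)))"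
    unfolding fps_eval_def[of _ g]
    by (rule strongly_linear_nsum[OF strongly_linear_fps_eval[OF \<psi>] summable_family_fps[OF \<psi>], symmetric])
  also have "\<dots> = nsum UNIV (\<lambda>m. nsum UNIV (\<lambda>n. u (m, n)))"
    by (simp add: fps_eval_def u_def strongly_linear_scale[OF sl] funpow_add)
  also have "\<dots> = nsum (UNIV \<times> UNIV) u" by (rule nsum_iterated[OF u])
  also have "\<dots> = nsum UNIV (\<lambda>k. nsum {i \<in> UNIV \<times> UNIV. (\<lambda>(m, n). n + m) i = k} u)"
    by (rule nsum_fibres[OF u, symmetric]) simp
  also have "\<dots> = fps_eval \<psi> (f * g) v" unfolding fps_eval_def
  proof (rule nsum_cong)
    fix k :: nat
    have eq: "{i \<in> UNIV \<times> UNIV. (\<lambda>(m, n). n + m) i = k} = (\<lambda>n. (k - n, n)) ` {0..k}"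
    proof (intro equalityI subsetI)
      fix i assume "i \<in> {i \<in> UNIV \<times> UNIV. (\<lambda>(m, n). n + m) i = k}"
      then show "i \<in> (\<lambda>n. (k - n, n)) ` {0..k}"
        by (intro image_eqI[of _ _ "snd i"]) (auto simp: split_beta prod_eq_iff)
    qed auto
    have inj: "inj_on (\<lambda>n. (k - n, n)) {0..k}" by (auto simp: inj_on_def)
    show "nsum {i \<in> UNIV \<times> UNIV. (\<lambda>(m, n). n + m) i = k} u = scale (fps_nth (f * g) k) ((\<psi> ^^ k) v)"
      unfolding eq by (simp add: nsum_finite sum.reindex[OF inj] u_def fps_mult_nth scale.scale_sum_left)
  qed
  finally show ?thesis by simp
qed

lemma fps_eval_power: "\<psi> \<in> Lin_prec \<Longrightarrow> fps_eval \<psi> (f ^ n) v = (fps_eval \<psi> f ^^ n) v"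
  by (induction n) (simp_all add: fps_eval_1 fps_eval_mult)

lemma fps_eval_Lin_prec:
  assumes \<psi>: "\<psi> \<in> Lin_prec" and f: "fps_nth f 0 = 0"
  shows "fps_eval \<psi> f \<in> Lin_prec"
proof -
  have pow: "\<exists>p\<in>supp v. p \<le> q" if "q \<in> supp ((\<psi> ^^ n) v)" for n q v
    using that
  proof (induction n arbitrary: q)
    case (Suc n)
    then obtain p where "p \<in> supp ((\<psi> ^^ n) v)" "p < q"
      using contracting_supp[OF Lin_prec_contracting[OF \<psi>], of q "(\<psi> ^^ n) v"] by auto
    with Suc.IH[of p] show ?case by (meson order.trans less_imp_le)
  qed auto
  have "contracting (fps_eval \<psi> f)"
  proof (rule contractingI[OF strongly_linear_fps_eval[OF \<psi>]])
    fix v q assume "q \<in> supp (fps_eval \<psi> f v)"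
    then obtain n where n: "q \<in> supp (scale (fps_nth f n) ((\<psi> ^^ n) v))"
      using supp_nsum[OF summable_family_fps[OF \<psi>]] unfolding fps_eval_def by blast
    then have "n \<noteq> 0" using f by (intro notI) (simp add: supp_zero)
    then obtain m where m: "n = Suc m" using not0_implies_Suc by blast
    then have "q \<in> supp (\<psi> ((\<psi> ^^ m) v))" using n supp_scale by fastforce
    then obtain p where "p \<in> supp ((\<psi> ^^ m) v)" "p < q"
      by (rule contracting_supp[OF Lin_prec_contracting[OF \<psi>]])
    then show "\<exists>p\<in>supp v. p < q" using pow by (meson order_le_less_trans)
  qed
  then show ?thesis using strongly_linear_fps_eval[OF \<psi>] by (simp add: Lin_prec_def)
qed

text \<open>Since \<open>g ^ n\<close> starts in degree \<open>n\<close>, each power of \<open>\<psi>\<close> occurs in only finitely many of the series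
  for \<open>(g(\<psi>))\<^sup>n\<close>, so that the two summations may be exchanged.\<close>

lemma fps_eval_compose:
  assumes \<psi>: "\<psi> \<in> Lin_prec" and g: "fps_nth g 0 = 0"
  shows "fps_eval (fps_eval \<psi> g) f v = fps_eval \<psi> (fps_compose f g) v"
proof -
  define u where "u = (\<lambda>(n, m). scale (fps_nth f n * fps_nth (g ^ n) m) ((\<psi> ^^ m) v))"
  have nz: "n \<le> m" if "u (n, m) \<noteq> 0" for n m
    using that startsby_zero_power_prefix[OF g] unfolding u_def by (cases "n \<le> m") auto
  have u: "summable_family (UNIV \<times> UNIV) u"
  proof (rule summable_family_pullback[OF summable_family_funpow_single[OF \<psi>, of v], where h = snd])
    show "finite {i \<in> UNIV \<times> UNIV. u i \<noteq> 0 \<and> snd i = j}" for j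
      by (rule finite_subset[of _ "{..j} \<times> {..j}"]) (use nz in auto)
  qed (auto simp: u_def dest!: subsetD[OF supp_scale])
  have "fps_eval (fps_eval \<psi> g) f v = nsum UNIV (\<lambda>n. nsum UNIV (\<lambda>m. u (n, m)))"
    unfolding fps_eval_def[of "fps_eval \<psi> g"] fps_eval_power[OF \<psi>, symmetric]
    by (simp add: u_def fps_eval_def nsum_scale[OF summable_family_fps[OF \<psi>], symmetric])
  also have "\<dots> = nsum UNIV (\<lambda>m. nsum UNIV (\<lambda>n. u (n, m)))" by (rule nsum_swap[OF u])
  also have "\<dots> = fps_eval \<psi> (fps_compose f g) v" unfolding fps_eval_def
  proof (rule nsum_cong)
    fix m
    have "nsum {0..m} (\<lambda>n. u (n, m)) = nsum UNIV (\<lambda>n. u (n, m))"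
      using nsum_reindex(2)[of "{0..m}" UNIV "\<lambda>n. n" "\<lambda>n. u (n, m)" "\<lambda>n. u (n, m)"] nz by force
    then show "nsum UNIV (\<lambda>n. u (n, m)) = scale (fps_nth (fps_compose f g) m) ((\<psi> ^^ m) v)"
      by (simp add: nsum_finite fps_compose_nth u_def scale.scale_sum_left)
  qed
  finally show ?thesis .
qed

section \<open>Exponential and logarithm\<close>

text \<open>The logarithm of \<open>\<sigma>\<close>, that is, the series \<open>log (1 + X)\<close> at \<open>\<sigma> - id\<close>.\<close>

definition lin_log :: "(('w::order, 'k::field_char_0) nseries \<Rightarrow> ('w, 'k) nseries) \<Rightarrow>
    ('w, 'k) nseries \<Rightarrow> ('w, 'k) nseries" where
  "lin_log \<sigma> = fps_eval (\<lambda>v. \<sigma> v - v) (fps_ln 1)"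

lemma lin_exp_eq_fps_eval: "lin_exp d = fps_eval d (fps_exp 1)"
  by (simp add: lin_exp_def lin_sum_def fps_eval_def fun_eq_iff)

lemma fps_exp_ln_inverse:
  fixes a :: "'k::field_char_0"
  shows "fps_compose (fps_ln 1) (fps_exp 1 - 1 :: 'k fps) = fps_X"
    and "fps_compose (fps_exp 1 - 1) (fps_ln 1 :: 'k fps) = fps_X"
proof -
  let ?e = "fps_exp 1 - 1 :: 'k fps"
  have e: "fps_nth ?e 0 = 0" "fps_nth ?e 1 \<noteq> 0" by simp_all
  have ln: "fps_ln 1 = fps_inv ?e" by (rule fps_ln_fps_exp_inv) simp
  show "fps_compose (fps_ln 1) ?e = fps_X" unfolding ln by (rule fps_inv[OF e])
  show "fps_compose ?e (fps_ln 1) = fps_X" unfolding ln by (rule fps_inv_right[OF e])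
qed

lemma lin_exp_minus_id:
  assumes d: "d \<in> Lin_prec"
  shows "(\<lambda>v. lin_exp d v - v) = fps_eval d (fps_exp 1 - 1)"
    and "(\<lambda>v. lin_exp d v - v) \<in> Lin_prec"
proof -
  show *: "(\<lambda>v. lin_exp d v - v) = fps_eval d (fps_exp 1 - 1)"
    by (simp add: fun_eq_iff fps_eval_diff[OF d] fps_eval_1[OF d] lin_exp_eq_fps_eval)
  show "(\<lambda>v. lin_exp d v - v) \<in> Lin_prec"
    unfolding * by (rule fps_eval_Lin_prec[OF d]) simp
qed

lemma lin_log_exp:
  assumes d: "d \<in> Lin_prec"
  shows "lin_log (lin_exp d) = d"
proof -
  have "lin_log (lin_exp d) = fps_eval (fps_eval d (fps_exp 1 - 1)) (fps_ln 1)"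
    by (simp add: lin_log_def lin_exp_minus_id(1)[OF d])
  also have "\<dots> = d"
    using fps_eval_compose[OF d, of "fps_exp 1 - 1" "fps_ln 1"]
    by (simp add: fps_exp_ln_inverse fps_eval_X[OF d] fun_eq_iff)
  finally show ?thesis .
qed

lemma lin_log_Lin_prec: "(\<lambda>v. \<sigma> v - v) \<in> Lin_prec \<Longrightarrow> lin_log \<sigma> \<in> Lin_prec"
  unfolding lin_log_def by (rule fps_eval_Lin_prec) simp_all

lemma lin_exp_log:
  assumes \<sigma>: "(\<lambda>v. \<sigma> v - v) \<in> Lin_prec"
  shows "lin_exp (lin_log \<sigma>) = \<sigma>"
proof
  fix v
  have "lin_exp (lin_log \<sigma>) v - v = fps_eval (lin_log \<sigma>) (fps_exp 1 - 1) v"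
    using lin_exp_minus_id(1)[OF lin_log_Lin_prec[OF \<sigma>]] by (simp add: fun_eq_iff)
  also have "\<dots> = \<sigma> v - v"
    using fps_eval_compose[OF \<sigma>, of "fps_ln 1" "fps_exp 1 - 1"]
    by (simp add: lin_log_def fps_exp_ln_inverse fps_eval_X[OF \<sigma>])
  finally show "lin_exp (lin_log \<sigma>) v = \<sigma> v" by simp
qed

section \<open>Derivations and automorphisms\<close>

lemma times_scale_left: "scale c a * b = scale c (a * b)"
  and times_scale_right: "a * scale c b = scale c (a * b)"
  for a b :: "('m::po_monoid, 'k::field) nseries"
proof -
  note on = coeff_times_on[OF noetherian_supp[of a] noetherian_supp[of b]]
  show "scale c a * b = scale c (a * b)"
    by (rule nseries_eqI)
      (simp add: on[OF supp_scale order_refl] on[OF order_refl order_refl] scale.rep_eq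
        sum_distrib_left split_beta mult.assoc)
  show "a * scale c b = scale c (a * b)"
    by (rule nseries_eqI)
      (simp add: on[OF order_refl supp_scale] on[OF order_refl order_refl] scale.rep_eq
        sum_distrib_left split_beta mult.left_commute)
qed

text \<open>With divided powers \<open>d\<^sup>n / n!\<close> the Leibniz rule for iterates has no binomial coefficients.\<close>

definition divided_power :: "(('w::order, 'k::field_char_0) nseries \<Rightarrow> ('w, 'k) nseries) \<Rightarrow> nat \<Rightarrow>
    ('w, 'k) nseries \<Rightarrow> ('w, 'k) nseries" where
  "divided_power d n v = scale (1 / fact n) ((d ^^ n) v)"

text \<open>The expansion of the product of \<open>exp (t d) a\<close> and \<open>exp (t d) b\<close> as a power series in \<open>t\<close> serves twice: for a derivation it is compared with
  \<open>exp (d) (a b)\<close> at \<open>t = 1\<close>, and for the logarithm of an automorphism its coefficients are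
  recovered from its values at all natural numbers \<open>t\<close>.\<close>

lemma
  fixes a b :: "('m::po_monoid, 'k::field_char_0) nseries"
  assumes d: "d \<in> Lin_prec"
  shows summable_family_exp_times:
      "summable_family UNIV (\<lambda>n. \<Sum>i\<le>n. divided_power d i a * divided_power d (n - i) b)" (is "summable_family _ ?G")
    and exp_times: "fps_eval d (fps_exp t) a * fps_eval d (fps_exp t) b =
      nsum UNIV (\<lambda>n. scale (t ^ n) (\<Sum>i\<le>n. divided_power d i a * divided_power d (n - i) b))"
proof -
  define u where "u = (\<lambda>t (i, j). scale (fps_nth (fps_exp t) i) ((d ^^ i) a) * scale (fps_nth (fps_exp t) j) ((d ^^ j) b))"
  have s: "summable_family UNIV (\<lambda>n. scale (fps_nth (fps_exp t) n) ((d ^^ n) v))" for t v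
    by (rule summable_family_fps[OF d])
  have u: "summable_family (UNIV \<times> UNIV) (u t)" for t
    unfolding u_def by (rule summable_family_times[OF s s])
  have uG: "nsum {z \<in> UNIV \<times> UNIV. fst z + snd z = n} (u t) = scale (t ^ n) (?G n)" for n t
  proof -
    have eq: "{z \<in> UNIV \<times> UNIV. fst z + snd z = n} = (\<lambda>i. (i, n - i)) ` {..n}"
      by force
    have inj: "inj_on (\<lambda>i. (i, n - i)) {..n}" by (auto simp: inj_on_def)
    have "u t (i, n - i) = scale (t ^ n) (divided_power d i a * divided_power d (n - i) b)" if "i \<le> n" for i
    proof -
      have "t ^ i * t ^ (n - i) = t ^ n" using that by (simp flip: power_add)
      then show ?thesis
        by (simp add: u_def divided_power_def times_scale_left times_scale_right field_simps)
    qed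
    then show ?thesis
      unfolding eq by (simp add: nsum_finite sum.reindex[OF inj] scale.scale_sum_right)
  qed
  have im: "(\<lambda>z. fst z + snd z) ` (UNIV \<times> UNIV) \<subseteq> (UNIV :: nat set)" by simp
  show "summable_family UNIV ?G"
    using summable_family_fibres[OF u im, of 1] unfolding uG by simp
  have "fps_eval d (fps_exp t) a * fps_eval d (fps_exp t) b = nsum (UNIV \<times> UNIV) (u t)"
    unfolding fps_eval_def u_def by (rule nsum_times[OF s s, symmetric])
  also have "\<dots> = nsum UNIV (\<lambda>n. scale (t ^ n) (?G n))"
    using nsum_fibres[OF u im, of t] unfolding uG by (rule sym)
  finally show "fps_eval d (fps_exp t) a * fps_eval d (fps_exp t) b = nsum UNIV (\<lambda>n. scale (t ^ n) (?G n))" .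
qed

lemma exp_eq_nsum_divided_power:
  "fps_eval d (fps_exp t) v = nsum UNIV (\<lambda>n. scale (t ^ n) (divided_power d n v))"
  by (simp add: fps_eval_def divided_power_def)

text \<open>Leibniz rule for iterates. The inductive step applies \<open>d\<close> to a product of two divided powers:
  the factor \<open>n + 1\<close> on the left splits as \<open>i + (n + 1 - i)\<close>, according to the factor
  differentiated last.\<close>

lemma divided_power_times:
  fixes a b :: "('m::po_monoid, 'k::field_char_0) nseries"
  assumes d: "d \<in> Der"
  shows "divided_power d n (a * b) = (\<Sum>i\<le>n. divided_power d i a * divided_power d (n - i) b)"
proof (induction n)
  case 0
  then show ?case by (simp add: divided_power_def)
next
  case (Suc n)
  have sl: "strongly_linear d" and leib: "d (a * b) = d a * b + a * d b" for a b
    using d by (auto simp: Der_def)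
  let ?A = "\<lambda>i. divided_power d i a" and ?B = "\<lambda>i. divided_power d i b"
  have step: "d (divided_power d n v) = scale (of_nat (Suc n)) (divided_power d (Suc n) v)" for n v
    by (simp add: divided_power_def strongly_linear_scale[OF sl] field_simps del: of_nat_Suc)
  have dsum: "d (\<Sum>i\<in>I. v i) = (\<Sum>i\<in>I. d (v i))" for v :: "nat \<Rightarrow> _" and I
    by (induction I rule: infinite_finite_induct)
      (simp_all add: strongly_linear_add[OF sl] strongly_linear_zero[OF sl])
  have "scale (of_nat (Suc n)) (divided_power d (Suc n) (a * b)) =
      (\<Sum>i\<le>n. d (?A i) * ?B (n - i)) + (\<Sum>i\<le>n. ?A i * d (?B (n - i)))"
    by (simp only: step[symmetric] Suc dsum leib sum.distrib)
  also have "(\<Sum>i\<le>n. d (?A i) * ?B (n - i)) = (\<Sum>i\<le>Suc n. scale (of_nat i) (?A i * ?B (Suc n - i)))"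
    by (subst sum.atMost_Suc_shift) (simp add: step times_scale_left del: of_nat_Suc)
  also have "(\<Sum>i\<le>n. ?A i * d (?B (n - i))) = (\<Sum>i\<le>Suc n. scale (of_nat (Suc n - i)) (?A i * ?B (Suc n - i)))"
    by (subst sum.atMost_Suc) (auto simp: step times_scale_right Suc_diff_le simp del: of_nat_Suc intro!: sum.cong)
  also have "(\<Sum>i\<le>Suc n. scale (of_nat i) (?A i * ?B (Suc n - i))) +
      (\<Sum>i\<le>Suc n. scale (of_nat (Suc n - i)) (?A i * ?B (Suc n - i))) =
      scale (of_nat (Suc n)) (\<Sum>i\<le>Suc n. ?A i * ?B (Suc n - i))"
    unfolding sum.distrib[symmetric] scale.scale_left_distrib[symmetric] scale.scale_sum_right of_nat_add[symmetric]
    by (rule sum.cong) simp_all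
  finally show ?case by (simp only: scale.scale_cancel_left of_nat_eq_0_iff nat.distinct simp_thms)
qed

lemma One_Aut_minus_id: "\<sigma> \<in> One_Aut \<Longrightarrow> (\<lambda>v. \<sigma> v - v) \<in> Lin_prec"
  using strongly_linear_minus[OF _ strongly_linear_id, of \<sigma>]
  by (auto simp: One_Aut_def Lin_prec_def contracting_def strongly_linear_def)

lemma Der_Lin_prec: "d \<in> Der \<Longrightarrow> d \<in> Lin_prec"
  by (simp add: Der_def Lin_prec_def)

lemma lin_exp_minus_inverse:
  assumes d: "d \<in> Lin_prec"
  shows "lin_exp d \<circ> fps_eval d (fps_exp (- 1)) = id" "fps_eval d (fps_exp (- 1)) \<circ> lin_exp d = id"
  using fps_exp_add_mult[of "1 :: 'b" "- 1"] fps_exp_add_mult[of "- 1 :: 'b" "1"]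
  by (simp_all add: fun_eq_iff lin_exp_eq_fps_eval fps_eval_mult[OF d, symmetric] fps_eval_1[OF d])

lemma lin_exp_One_Aut:
  fixes d :: "('m::po_monoid, 'k::field_char_0) nseries \<Rightarrow> ('m, 'k) nseries"
  assumes "d \<in> Der"
  shows "lin_exp d \<in> One_Aut"
proof -
  have d: "d \<in> Lin_prec" using assms by (rule Der_Lin_prec)
  have bij: "bij (lin_exp d)"
    using lin_exp_minus_inverse[OF d] by (metis o_bij)
  have mult: "lin_exp d (a * b) = lin_exp d a * lin_exp d b" for a b
    unfolding lin_exp_eq_fps_eval exp_times[OF d]
    by (simp add: exp_eq_nsum_divided_power divided_power_times[OF assms])
  \<comment> \<open>The value at \<open>1\<close> is a left unit for the range of the map, which is the whole algebra.\<close>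
  have "lin_exp d 1 = 1"
  proof -
    obtain x where x: "lin_exp d x = 1" using bij by (metis bij_pointE)
    then show ?thesis using mult[of 1 x] by simp
  qed
  moreover have "contracting (\<lambda>v. lin_exp d v - v)"
    using lin_exp_minus_id(2)[OF d] by (simp add: Lin_prec_def)
  moreover have "strongly_linear (lin_exp d)"
    unfolding lin_exp_eq_fps_eval by (rule strongly_linear_fps_eval[OF d])
  ultimately show ?thesis using bij mult by (simp add: One_Aut_def contracting_def)
qed

text \<open>At a fixed exponent the hypothesis says that a polynomial vanishes at all natural numbers; in
  characteristic zero these are infinitely many points, so that its coefficients are zero.\<close>

lemma nsum_powers_eq_0_imp:
  fixes v :: "nat \<Rightarrow> ('w::order, 'k::field_char_0) nseries"
  assumes v: "summable_family UNIV v"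
    and zero: "\<And>N :: nat. nsum UNIV (\<lambda>n. scale (of_nat N ^ n) (v n)) = 0"
  shows "v n = 0"
proof (rule nseries_eqI)
  fix p
  have "finite {n. p \<in> supp (v n)}" using v by (auto simp: summable_family_def)
  then obtain K where K: "\<forall>n\<in>{n. p \<in> supp (v n)}. n \<le> K"
    unfolding finite_nat_set_iff_bounded_le by blast
  have poly: "(\<Sum>n\<le>K. coeff (v n) p * of_nat N ^ n) = 0" for N
  proof -
    have s: "summable_family UNIV (\<lambda>n. scale (of_nat N ^ n) (v n))"
      by (rule summable_family_dominated[OF v supp_scale])
    have "(\<Sum>n\<le>K. coeff (scale (of_nat N ^ n) (v n)) p) = coeff 0 p"
      unfolding zero[of N, symmetric]
      by (rule nsum_coeff_superset[OF s, symmetric]) (use K supp_scale in auto)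
    then show ?thesis by (simp add: scale.rep_eq zero_nseries.rep_eq mult.commute)
  qed
  define P where "P = (\<Sum>n\<le>K. monom (coeff (v n) p) n)"
  have P: "poly.coeff P n = (if n \<le> K then coeff (v n) p else 0)" for n
    by (simp add: P_def Polynomial.coeff_sum coeff_monom)
  have "P = 0"
  proof (rule ccontr)
    assume "P \<noteq> 0"
    then have "finite {x. poly P x = 0}" by (rule poly_roots_finite)
    moreover have "range (of_nat :: nat \<Rightarrow> 'k) \<subseteq> {x. poly P x = 0}"
      using poly by (auto simp: P_def poly_sum poly_monom)
    ultimately have "finite (range (of_nat :: nat \<Rightarrow> 'k))" by (rule rev_finite_subset)
    then show False using finite_imageD inj_of_nat infinite_UNIV_nat by blast
  qed
  then have "coeff (v n) p = 0" if "n \<le> K" using P[of n] that by simp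
  moreover have "coeff (v n) p = 0" if "\<not> n \<le> K"
    using K that by (auto simp: supp_def)
  ultimately show "coeff (v n) p = coeff 0 p" by (auto simp: zero_nseries.rep_eq)
qed

text \<open>Let \<open>d = log \<sigma>\<close>. For every natural number \<open>N\<close> the power \<open>\<sigma>\<^sup>N = exp (N d)\<close> is multiplicative.
  Both sides of \<open>\<sigma>\<^sup>N (a b) = \<sigma>\<^sup>N a \<sigma>\<^sup>N b\<close> are power series in \<open>N\<close>, so their coefficients agree; the
  equality of the coefficients of \<open>N\<close> is the Leibniz rule for \<open>d\<close>.\<close>

lemma lin_log_Der:
  fixes \<sigma> :: "('m::po_monoid, 'k::field_char_0) nseries \<Rightarrow> ('m, 'k) nseries"
  assumes "\<sigma> \<in> One_Aut"
  shows "lin_log \<sigma> \<in> Der"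
proof -
  define d where "d = lin_log \<sigma>"
  have d: "d \<in> Lin_prec" unfolding d_def by (rule lin_log_Lin_prec[OF One_Aut_minus_id[OF assms]])
  have exp: "lin_exp d = \<sigma>" unfolding d_def by (rule lin_exp_log[OF One_Aut_minus_id[OF assms]])
  have pow: "fps_eval d (fps_exp (of_nat N)) = \<sigma> ^^ N" for N
    using fps_eval_power[OF d, of "fps_exp 1" N] unfolding exp[unfolded lin_exp_eq_fps_eval]
    by (simp add: fun_eq_iff fps_exp_power_mult)
  have mult: "(\<sigma> ^^ N) (a * b) = (\<sigma> ^^ N) a * (\<sigma> ^^ N) b" for N a b
    using assms by (induction N) (auto simp: One_Aut_def)
  have "d (a * b) = d a * b + a * d b" for a b
  proof -
    let ?F = "\<lambda>n. divided_power d n (a * b)"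
    let ?G = "\<lambda>n. \<Sum>i\<le>n. divided_power d i a * divided_power d (n - i) b"
    have F: "summable_family UNIV ?F"
      unfolding divided_power_def
      by (rule summable_family_dominated[OF summable_family_funpow_single[OF d] supp_scale])
    note G = summable_family_exp_times[OF d, of a b]
    have "?F 1 - ?G 1 = 0"
    proof (rule nsum_powers_eq_0_imp[OF summable_family_diff[OF F G]])
      fix N :: nat
      have "nsum UNIV (\<lambda>n. scale (of_nat N ^ n) (?F n - ?G n)) =
          nsum UNIV (\<lambda>n. scale (of_nat N ^ n) (?F n)) - nsum UNIV (\<lambda>n. scale (of_nat N ^ n) (?G n))"
        unfolding scale.scale_right_diff_distrib
        by (rule nsum_diff[OF summable_family_dominated[OF F supp_scale]
              summable_family_dominated[OF G supp_scale]])
      also have "\<dots> = 0"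
        unfolding exp_times[OF d, symmetric] exp_eq_nsum_divided_power[symmetric] pow mult by simp
      finally show "nsum UNIV (\<lambda>n. scale (of_nat N ^ n) (?F n - ?G n)) = 0" .
    qed
    then show ?thesis by (simp add: divided_power_def add.commute)
  qed
  then show ?thesis using d by (simp add: Der_def Lin_prec_def d_def)
qed

section \<open>The Baker--Campbell--Hausdorff series\<close>

text \<open>From \<open>\<sigma> (\<tau> v) - v = (\<sigma> (\<tau> v) - \<tau> v) + (\<tau> v - v)\<close>: an exponent of \<open>\<tau> v\<close> is an exponent of \<open>v\<close> or lies
  above one.\<close>

lemma Lin_prec_unipotent_comp:
  assumes \<sigma>: "(\<lambda>v. \<sigma> v - v) \<in> Lin_prec" and \<tau>: "(\<lambda>v. \<tau> v - v) \<in> Lin_prec"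
  shows "(\<lambda>v. \<sigma> (\<tau> v) - v) \<in> Lin_prec"
proof -
  \<comment> \<open>A sum of strongly linear maps, written as a difference.\<close>
  have sl: "strongly_linear f" if "(\<lambda>v. f v - v) \<in> Lin_prec" for f :: "('a, 'b) nseries \<Rightarrow> _"
  proof -
    have "strongly_linear (\<lambda>v. (f v - v) - (0 - v))"
    proof (rule strongly_linear_minus)
      show "strongly_linear (\<lambda>v. f v - v)" using that by (simp add: Lin_prec_def)
      show "strongly_linear (\<lambda>v :: ('a, 'b) nseries. 0 - v)"
        using strongly_linear_minus[OF strongly_linear_minus[OF strongly_linear_id strongly_linear_id] strongly_linear_id]
        by simp
    qed
    then show ?thesis by simp
  qed
  have "strongly_linear (\<lambda>v. \<sigma> (\<tau> v) - v)"
    by (rule strongly_linear_minus[OF strongly_linear_comp[OF sl[OF \<sigma>] sl[OF \<tau>]] strongly_linear_id])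
  moreover have "contracting (\<lambda>v. \<sigma> (\<tau> v) - v)"
  proof (rule contractingI)
    fix v q assume "q \<in> supp (\<sigma> (\<tau> v) - v)"
    then have "q \<in> supp (\<tau> v - v) \<or> q \<in> supp (\<sigma> (\<tau> v) - \<tau> v)"
      by (auto simp: supp_def minus_nseries.rep_eq)
    then consider "q \<in> supp (\<tau> v - v)" | "q \<in> supp (\<sigma> (\<tau> v) - \<tau> v)" by blast
    then show "\<exists>p\<in>supp v. p < q"
    proof cases
      case 1
      then show ?thesis by (rule contracting_supp[OF Lin_prec_contracting[OF \<tau>]]) blast
    next
      case 2
      then obtain p where p: "p \<in> supp (\<tau> v)" "p < q"
        by (rule contracting_supp[OF Lin_prec_contracting[OF \<sigma>]])
      show ?thesis
      proof (cases "p \<in> supp v")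
        case False
        then have "p \<in> supp (\<tau> v - v)" using p by (auto simp: supp_def minus_nseries.rep_eq)
        then obtain p' where "p' \<in> supp v" "p' < p"
          by (rule contracting_supp[OF Lin_prec_contracting[OF \<tau>]])
        then show ?thesis using p(2) by (intro bexI[of _ p']) (rule order.strict_trans)
      qed (use p in blast)
    qed
  qed fact
  ultimately show ?thesis by (simp add: Lin_prec_def)
qed

lemma nsum_remove:
  fixes v :: "'i \<Rightarrow> ('w::order, 'k::ab_group_add) nseries"
  assumes v: "summable_family I v" and i: "i \<in> I"
  shows "nsum I v = v i + nsum (I - {i}) v"
proof -
  have "nsum I v = nsum (UNIV :: bool set) (\<lambda>b. nsum {j \<in> I. (j = i) = b} v)"
    by (rule nsum_fibres[OF v, symmetric]) simp
  also have "\<dots> = nsum {j \<in> I. j = i} v + nsum {j \<in> I. j \<noteq> i} v"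
    by (simp add: nsum_finite UNIV_bool)
  also have "{j \<in> I. j = i} = {i}" using i by blast
  also have "{j \<in> I. j \<noteq> i} = I - {i}" by blast
  finally show ?thesis by (simp add: nsum_finite)
qed

text \<open>The coefficient of a monomial \<open>mps\<close> in the expansion of \<open>(exp X\<^sub>0 exp X\<^sub>1 - 1)\<^sup>n\<close> with
  \<open>n = length mps\<close>.\<close>

definition bch_word_coeff :: "(nat \<times> nat) list \<Rightarrow> 'k::field_char_0" where
  "bch_word_coeff mps = 1 / prod_list (map (\<lambda>(m, p). fact m * fact p) mps)"

lemma exp_comp_exp_minus_id:
  assumes \<phi>0: "\<phi>0 \<in> Lin_prec" and \<phi>1: "\<phi>1 \<in> Lin_prec"
  shows "lin_exp \<phi>0 (lin_exp \<phi>1 v) - v =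
      nsum {(m, p). m + p \<ge> 1} (\<lambda>mp. scale (bch_word_coeff [mp]) (word_comp \<phi>0 \<phi>1 (bch_word [mp]) v))"
proof -
  define u where "u mp = scale (bch_word_coeff [mp]) (word_comp \<phi>0 \<phi>1 (bch_word [mp]) v)" for mp
  have u_eq: "u (m, p) = scale (1 / fact m) ((\<phi>0 ^^ m) (scale (1 / fact p) ((\<phi>1 ^^ p) v)))" for m p
    by (simp add: u_def bch_word_coeff_def bch_word_def word_comp_append word_comp_replicate
        strongly_linear_scale[OF strongly_linear_funpow[OF Lin_prec_strongly_linear[OF \<phi>0]]] mult.commute)
  have words: "summable_family (UNIV \<times> {()}) (\<lambda>(\<theta>, i). word_comp \<phi>0 \<phi>1 \<theta> v)"
    by (rule summable_family_words[OF \<phi>0 \<phi>1 summable_family_finite]) simp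
  have u: "summable_family (UNIV \<times> UNIV) u"
  proof (rule summable_family_pullback[OF words, where h = "\<lambda>mp. (bch_word [mp], ())"])
    fix z :: "bool list \<times> unit"
    have "{mp \<in> UNIV \<times> UNIV. u mp \<noteq> 0 \<and> (bch_word [mp], ()) = z}
        \<subseteq> {..length (fst z)} \<times> {..length (fst z)}"
      by (auto simp: bch_word_def)
    then show "finite {mp \<in> UNIV \<times> UNIV. u mp \<noteq> 0 \<and> (bch_word [mp], ()) = z}"
      by (rule finite_subset) simp
  qed (auto simp: u_def dest!: subsetD[OF supp_scale])
  have u': "summable_family (UNIV \<times> UNIV) (\<lambda>(p, m). u (m, p))"
    using summable_family_swap[OF u] by simp
  have sl0: "strongly_linear (lin_exp \<phi>0)"
    unfolding lin_exp_eq_fps_eval by (rule strongly_linear_fps_eval[OF \<phi>0])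
  have "lin_exp \<phi>0 (lin_exp \<phi>1 v) = nsum UNIV (\<lambda>p. lin_exp \<phi>0 (scale (1 / fact p) ((\<phi>1 ^^ p) v)))"
    using strongly_linear_nsum[OF sl0 summable_family_fps[OF \<phi>1, of "fps_exp 1" v]]
    by (simp add: lin_exp_eq_fps_eval[of \<phi>1] fps_eval_def)
  also have "\<dots> = nsum UNIV (\<lambda>p. nsum UNIV (\<lambda>m. u (m, p)))"
    by (simp add: u_eq lin_exp_eq_fps_eval[of \<phi>0] fps_eval_def)
  also have "\<dots> = nsum (UNIV \<times> UNIV) u"
    by (rule trans[OF nsum_swap[OF u, symmetric] nsum_iterated[OF u]])
  also have "\<dots> = u (0, 0) + nsum (UNIV - {(0, 0)}) u"
    using nsum_remove[OF u, of "(0, 0)"] by simp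
  also have "u (0, 0) = v" by (simp add: u_eq)
  also have "UNIV - {(0, 0)} = {(m, p). m + p \<ge> (1 :: nat)}" by auto
  finally show ?thesis by (simp add: u_def)
qed

text \<open>The series \<open>bch\<close> is \<open>log (exp X\<^sub>0 exp X\<^sub>1)\<close> with its terms collected by words. With
  \<open>\<zeta> = exp \<phi>0 exp \<phi>1 - id\<close>, the value \<open>\<zeta>\<^sup>n v\<close> is the sum over all lists of \<open>n\<close> pairs \<open>(m, p) \<noteq> (0, 0)\<close>
  of the corresponding terms \<open>W\<close>. Hence the logarithm is a sum over all such lists, grouped by
  their length; grouping it instead by the word that a list spells gives \<open>bch\<close>. The family of all
  \<open>W\<close> is summable since only finitely many lists spell a given word.\<close>

lemma bch_eq_log:
  assumes \<phi>0: "\<phi>0 \<in> Lin_prec" and \<phi>1: "\<phi>1 \<in> Lin_prec"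
  shows "bch \<phi>0 \<phi>1 = lin_log (lin_exp \<phi>0 \<circ> lin_exp \<phi>1)"
proof
  fix v
  define Q where "Q = {(m, p). m + p \<ge> (1 :: nat)}"
  define \<zeta> where "\<zeta> v = lin_exp \<phi>0 (lin_exp \<phi>1 v) - v" for v
  define W where "W mps v = scale (bch_word_coeff mps) (word_comp \<phi>0 \<phi>1 (bch_word mps) v)" for mps v
  define L where "L = {mps. set mps \<subseteq> Q}"
  define Ln where "Ln n = {mps \<in> L. length mps = n}" for n
  have \<zeta>: "\<zeta> \<in> Lin_prec"
    unfolding \<zeta>_def
    by (rule Lin_prec_unipotent_comp[OF lin_exp_minus_id(2)[OF \<phi>0] lin_exp_minus_id(2)[OF \<phi>1]])
  have sl: "strongly_linear (word_comp \<phi>0 \<phi>1 \<theta>)" for \<theta>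
  proof (induction \<theta>)
    case (Cons t \<theta>)
    have "strongly_linear (if t then \<phi>1 else \<phi>0)"
      using \<phi>0 \<phi>1 by (simp add: Lin_prec_strongly_linear)
    from strongly_linear_comp[OF this Cons] show ?case by (simp add: word_comp_Cons o_def)
  qed (use strongly_linear_id in \<open>simp add: word_comp_Nil id_def\<close>)
  have words: "summable_family (UNIV \<times> {()}) (\<lambda>(\<theta>, i). word_comp \<phi>0 \<phi>1 \<theta> v)"
    by (rule summable_family_words[OF \<phi>0 \<phi>1 summable_family_finite]) simp
  \<comment> \<open>The empty list lies in \<open>L\<close> but in no \<open>bch_terms\<close>; its coefficient below is zero, as the
    logarithmic series has no constant term.\<close>
  have fin: "finite {mps \<in> L. bch_word mps = \<theta>}"
    and terms: "bch_terms \<theta> \<subseteq> {mps \<in> L. bch_word mps = \<theta>}" "{mps \<in> L. bch_word mps = \<theta>} - bch_terms \<theta> \<subseteq> {[]}" for \<theta>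
  proof -
    show "bch_terms \<theta> \<subseteq> {mps \<in> L. bch_word mps = \<theta>}"
      by (auto simp: L_def Q_def bch_terms_def)
    show *: "{mps \<in> L. bch_word mps = \<theta>} - bch_terms \<theta> \<subseteq> {[]}"
    proof
      fix mps assume "mps \<in> {mps \<in> L. bch_word mps = \<theta>} - bch_terms \<theta>"
      then show "mps \<in> {[]}" by (cases mps) (auto simp: L_def Q_def bch_terms_def)
    qed
    have "finite (bch_terms \<theta> \<union> {[]})" by (simp add: finite_bch_terms)
    then show "finite {mps \<in> L. bch_word mps = \<theta>}"
      by (rule rev_finite_subset) (use * in blast)
  qed
  have W: "summable_family L (\<lambda>mps. W mps v)"
  proof (rule summable_family_pullback[OF words, where h = "\<lambda>mps. (bch_word mps, ())"])
    show "finite {mps \<in> L. W mps v \<noteq> 0 \<and> (bch_word mps, ()) = z}" for z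
      by (rule finite_subset[OF _ fin[of "fst z"]]) auto
  qed (auto simp: W_def dest!: subsetD[OF supp_scale])
  have \<zeta>_W: "\<zeta> (W mps v) = nsum Q (\<lambda>q. W (q # mps) v)" for mps
    unfolding \<zeta>_def exp_comp_exp_minus_id[OF \<phi>0 \<phi>1] Q_def[symmetric]
  proof (rule nsum_cong)
    fix q
    have "bch_word (q # mps) = bch_word [q] @ bch_word mps" by (simp add: bch_word_def)
    moreover have "bch_word_coeff (q # mps) = bch_word_coeff [q] * (bch_word_coeff mps :: 'b)"
      by (simp add: bch_word_coeff_def)
    ultimately show "scale (bch_word_coeff [q]) (word_comp \<phi>0 \<phi>1 (bch_word [q]) (W mps v)) = W (q # mps) v"
      by (simp add: W_def word_comp_append strongly_linear_scale[OF sl])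
  qed
  have Wn: "summable_family (Ln n) (\<lambda>mps. W mps v)" for n
    by (rule summable_family_subset[OF W]) (auto simp: Ln_def)
  have pow: "(\<zeta> ^^ n) v = nsum (Ln n) (\<lambda>mps. W mps v)" for n
  proof (induction n)
    case 0
    have "Ln 0 = {[]}" by (auto simp: Ln_def L_def)
    then show ?case by (simp add: nsum_finite W_def bch_word_coeff_def bch_word_def word_comp_Nil)
  next
    case (Suc n)
    let ?g = "\<lambda>(mps, q). q # mps"
    have im: "?g ` (Ln n \<times> Q) = Ln (Suc n)"
    proof (intro equalityI subsetI)
      fix mps assume "mps \<in> Ln (Suc n)"
      then show "mps \<in> ?g ` (Ln n \<times> Q)"
        by (cases mps) (auto simp: Ln_def L_def intro!: image_eqI[of _ _ "(tl mps, hd mps)"])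
    qed (auto simp: Ln_def L_def)
    have inj: "inj_on ?g (Ln n \<times> Q)" by (auto simp: inj_on_def)
    have s: "summable_family (?g ` (Ln n \<times> Q)) (\<lambda>mps. W mps v) \<longleftrightarrow>
          summable_family (Ln n \<times> Q) (\<lambda>z. W (?g z) v)"
        "nsum (?g ` (Ln n \<times> Q)) (\<lambda>mps. W mps v) = nsum (Ln n \<times> Q) (\<lambda>z. W (?g z) v)"
      by (rule nsum_reindex[OF order_refl inj]; simp)+
    have s': "summable_family (Ln n \<times> Q) (\<lambda>z. W (?g z) v)" using s(1) Wn im by simp
    have "(\<zeta> ^^ Suc n) v = nsum (Ln n) (\<lambda>mps. \<zeta> (W mps v))"
      using strongly_linear_nsum[OF Lin_prec_strongly_linear[OF \<zeta>] Wn] Suc by simp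
    also have "\<dots> = nsum (Ln (Suc n)) (\<lambda>mps. W mps v)"
      using nsum_iterated[OF s'] s(2) by (simp add: \<zeta>_W im)
    finally show ?case .
  qed
  let ?l = "\<lambda>n. fps_nth (fps_ln 1 :: 'b fps) n"
  have lW: "summable_family L (\<lambda>mps. scale (?l (length mps)) (W mps v))"
    by (rule summable_family_dominated[OF W supp_scale])
  have "lin_log (lin_exp \<phi>0 \<circ> lin_exp \<phi>1) v = nsum UNIV (\<lambda>n. scale (?l n) (nsum (Ln n) (\<lambda>mps. W mps v)))"
    by (simp add: lin_log_def fps_eval_def \<zeta>_def[symmetric] pow[symmetric])
  also have "\<dots> = nsum UNIV (\<lambda>n. nsum {mps \<in> L. length mps = n} (\<lambda>mps. scale (?l (length mps)) (W mps v)))"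
  proof (rule nsum_cong)
    fix n
    show "scale (?l n) (nsum (Ln n) (\<lambda>mps. W mps v)) =
        nsum {mps \<in> L. length mps = n} (\<lambda>mps. scale (?l (length mps)) (W mps v))"
      unfolding Ln_def[symmetric] nsum_scale[OF Wn, symmetric]
      by (rule nsum_cong) (simp add: Ln_def)
  qed
  also have "\<dots> = nsum L (\<lambda>mps. scale (?l (length mps)) (W mps v))"
    by (rule nsum_fibres[OF lW]) simp
  also have "\<dots> = nsum UNIV (\<lambda>\<theta>. nsum {mps \<in> L. bch_word mps = \<theta>} (\<lambda>mps. scale (?l (length mps)) (W mps v)))"
    by (rule nsum_fibres[OF lW, symmetric]) simp
  also have "\<dots> = nsum UNIV (\<lambda>\<theta>. scale (bch_coeff \<theta>) (word_comp \<phi>0 \<phi>1 \<theta> v))"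
  proof (rule nsum_cong)
    fix \<theta>
    have "nsum {mps \<in> L. bch_word mps = \<theta>} (\<lambda>mps. scale (?l (length mps)) (W mps v)) =
        (\<Sum>mps \<in> {mps \<in> L. bch_word mps = \<theta>}. scale (?l (length mps) * bch_word_coeff mps) (word_comp \<phi>0 \<phi>1 \<theta> v))"
      unfolding nsum_finite[OF fin] by (rule sum.cong) (auto simp: W_def)
    also have "\<dots> = (\<Sum>mps \<in> bch_terms \<theta>. scale (?l (length mps) * bch_word_coeff mps) (word_comp \<phi>0 \<phi>1 \<theta> v))"
      by (rule sum.mono_neutral_right[OF fin terms(1)]) (use terms(2)[of \<theta>] in auto)
    also have "\<dots> = scale (bch_coeff \<theta>) (word_comp \<phi>0 \<phi>1 \<theta> v)"
      unfolding bch_coeff_def scale.scale_sum_left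
    proof (rule sum.cong)
      fix mps assume "mps \<in> bch_terms \<theta>"
      then have "length mps \<ge> 1" by (simp add: bch_terms_def)
      then obtain k where k: "length mps = Suc k" by (cases "length mps") auto
      show "scale (?l (length mps) * bch_word_coeff mps) (word_comp \<phi>0 \<phi>1 \<theta> v) =
          scale ((- 1) ^ (length mps + 1) / of_nat (length mps) *
            (1 / prod_list (map (\<lambda>(m, p). fact m * fact p) mps))) (word_comp \<phi>0 \<phi>1 \<theta> v)"
        by (simp add: k fps_ln_nth bch_word_coeff_def del: of_nat_Suc)
    qed simp
    finally show "nsum {mps \<in> L. bch_word mps = \<theta>} (\<lambda>mps. scale (?l (length mps)) (W mps v)) =
        scale (bch_coeff \<theta>) (word_comp \<phi>0 \<phi>1 \<theta> v)" .
  qed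
  finally show "bch \<phi>0 \<phi>1 v = lin_log (lin_exp \<phi>0 \<circ> lin_exp \<phi>1) v"
    by (simp add: bch_def lin_sum_def)
qed

section \<open>The group isomorphism\<close>

lemma One_Aut_comp:
  assumes "\<sigma> \<in> One_Aut" "\<tau> \<in> One_Aut"
  shows "\<sigma> \<circ> \<tau> \<in> One_Aut"
proof -
  have "contracting (\<lambda>v. \<sigma> (\<tau> v) - v)"
    using Lin_prec_unipotent_comp[OF One_Aut_minus_id[OF assms(1)] One_Aut_minus_id[OF assms(2)]]
    by (rule Lin_prec_contracting)
  moreover have "strongly_linear (\<lambda>v. \<sigma> (\<tau> v))"
    by (rule strongly_linear_comp) (use assms in \<open>auto simp: One_Aut_def\<close>)
  moreover have "bij (\<sigma> \<circ> \<tau>)" using assms by (intro bij_comp) (auto simp: One_Aut_def)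
  ultimately show ?thesis
    using assms by (simp add: One_Aut_def contracting_def o_def)
qed

lemma lin_exp_lin_log: "\<sigma> \<in> One_Aut \<Longrightarrow> lin_exp (lin_log \<sigma>) = \<sigma>"
  by (rule lin_exp_log[OF One_Aut_minus_id])

lemma lin_log_lin_exp: "d \<in> Der \<Longrightarrow> lin_log (lin_exp d) = d"
  by (rule lin_log_exp[OF Der_Lin_prec])

lemma bij_betw_lin_exp: "bij_betw lin_exp Der One_Aut"
  by (rule bij_betw_byWitness[of _ lin_log])
    (auto simp: lin_log_lin_exp lin_exp_lin_log lin_exp_One_Aut lin_log_Der)

lemma bch_Der: "bch d e \<in> Der"
  and lin_exp_bch: "lin_exp (bch d e) = lin_exp d \<circ> lin_exp e"
  if "d \<in> Der" "e \<in> Der"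
  using that One_Aut_comp[OF lin_exp_One_Aut[of d] lin_exp_One_Aut[of e]]
  by (simp_all add: bch_eq_log Der_Lin_prec lin_log_Der lin_exp_lin_log)

lemma zero_Der: "(\<lambda>_. 0) \<in> Der"
proof -
  have "strongly_linear (\<lambda>_. 0)"
    using strongly_linear_minus[OF strongly_linear_id strongly_linear_id] by simp
  then show ?thesis
    by (auto simp: Der_def supp_zero intro: contractingI)
qed

lemma lin_exp_zero: "lin_exp (\<lambda>_. 0) = (id :: ('w::order, 'k::field_char_0) nseries \<Rightarrow> ('w, 'k) nseries)"
proof
  fix v :: "('w, 'k) nseries"
  let ?u = "\<lambda>n. scale (1 / fact n) (((\<lambda>_ :: ('w, 'k) nseries. 0 :: ('w, 'k) nseries) ^^ n) v)"
  have "?u n = 0" if "n \<noteq> 0" for n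
  proof -
    obtain k where "n = Suc k" using \<open>n \<noteq> 0\<close> by (cases n) auto
    then show ?thesis by simp
  qed
  then have "nsum {0} ?u = nsum UNIV ?u"
    using nsum_reindex(2)[of "{0}" UNIV "\<lambda>n. n" ?u ?u] by simp
  then show "lin_exp (\<lambda>_. 0) v = id v" by (simp add: nsum_finite lin_exp_def lin_sum_def)
qed

lemma minus_Der:
  fixes d :: "('m::po_monoid, 'k::field_char_0) nseries \<Rightarrow> ('m, 'k) nseries"
  assumes d: "d \<in> Der"
  shows "(\<lambda>v. - d v) \<in> Der"
proof -
  have eq: "(\<lambda>v. - d v) = (\<lambda>v. 0 - d v)" by simp
  have "strongly_linear (\<lambda>v. - d v)"
    using strongly_linear_minus[of "\<lambda>_. 0" d] zero_Der[where 'a = 'm and 'b = 'k] d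
    by (simp add: Der_def)
  moreover have "supp (- d v) = supp (d v)" for v
    by (simp add: supp_def uminus_nseries.rep_eq)
  ultimately have "contracting (\<lambda>v. - d v)"
    by (intro contractingI) (use d in \<open>auto simp: Der_def elim: contracting_supp\<close>)
  then show ?thesis
    using d \<open>strongly_linear (\<lambda>v. - d v)\<close> by (simp add: Der_def)
qed

lemma lin_exp_minus:
  assumes d: "d \<in> Lin_prec"
  shows "lin_exp (\<lambda>v. - d v) = fps_eval d (fps_exp (- 1))"
proof -
  have "((\<lambda>v. - d v) ^^ n) v = scale ((- 1) ^ n) ((d ^^ n) v)" for n v
  proof (induction n)
    case (Suc n)
    then show ?case by (simp add: strongly_linear_scale[OF Lin_prec_strongly_linear[OF d]])
  qed simp
  then show ?thesis
    by (simp add: fun_eq_iff lin_exp_def lin_sum_def fps_eval_def mult.commute)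
qed

text \<open>The exponential is a bijection that carries \<open>bch\<close> to composition, so the group axioms for
  derivations follow from those for maps, and the inverse of an automorphism \<open>exp d\<close> is the
  automorphism \<open>exp (- d)\<close>.\<close>

theorem theorem3p13:
  "group (Der_group :: (('m::po_monoid, 'k::field_char_0) nseries \<Rightarrow> ('m, 'k) nseries) monoid) \<and>
   group (One_Aut_group :: (('m, 'k) nseries \<Rightarrow> ('m, 'k) nseries) monoid) \<and>
   (lin_exp :: (('m, 'k) nseries \<Rightarrow> ('m, 'k) nseries) \<Rightarrow> ('m, 'k) nseries \<Rightarrow> ('m, 'k) nseries)
     \<in> iso Der_group One_Aut_group"
proof (intro conjI)
  let ?D = "Der_group :: (('m, 'k) nseries \<Rightarrow> ('m, 'k) nseries) monoid"
  let ?A = "One_Aut_group :: (('m, 'k) nseries \<Rightarrow> ('m, 'k) nseries) monoid"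
  have exp_inj: "d = e" if "d \<in> Der" "e \<in> Der" "lin_exp d = lin_exp e"
    for d e :: "('m, 'k) nseries \<Rightarrow> ('m, 'k) nseries"
    by (rule inj_onD[OF bij_betw_imp_inj_on[OF bij_betw_lin_exp] that(3,1,2)])
  have inv: "lin_exp (\<lambda>v. - d v) \<circ> lin_exp d = id"
    if "d \<in> Der" for d :: "('m, 'k) nseries \<Rightarrow> ('m, 'k) nseries"
    using lin_exp_minus_inverse(2)[OF Der_Lin_prec[OF that]]
    by (simp add: lin_exp_minus[OF Der_Lin_prec[OF that]])
  show "group ?D"
  proof (rule groupI)
    fix d e f assume "d \<in> carrier ?D" "e \<in> carrier ?D" "f \<in> carrier ?D"
    then have in_Der: "d \<in> Der" "e \<in> Der" "f \<in> Der" by (simp_all add: Der_group_def)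
    have "bch (bch d e) f = bch d (bch e f)"
      by (rule exp_inj) (simp_all add: in_Der bch_Der lin_exp_bch o_assoc)
    then show "d \<otimes>\<^bsub>?D\<^esub> e \<otimes>\<^bsub>?D\<^esub> f = d \<otimes>\<^bsub>?D\<^esub> (e \<otimes>\<^bsub>?D\<^esub> f)" by (simp add: Der_group_def)
  next
    fix d assume "d \<in> carrier ?D"
    then have d: "d \<in> Der" by (simp add: Der_group_def)
    have "bch (\<lambda>_. 0) d = d"
      by (rule exp_inj) (simp_all add: d bch_Der lin_exp_bch zero_Der lin_exp_zero)
    then show "\<one>\<^bsub>?D\<^esub> \<otimes>\<^bsub>?D\<^esub> d = d" by (simp add: Der_group_def)
    have "bch (\<lambda>v. - d v) d = (\<lambda>_. 0)"
      by (rule exp_inj) (simp_all add: d bch_Der lin_exp_bch zero_Der lin_exp_zero minus_Der inv)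
    then show "\<exists>e\<in>carrier ?D. e \<otimes>\<^bsub>?D\<^esub> d = \<one>\<^bsub>?D\<^esub>"
      by (intro bexI[of _ "\<lambda>v. - d v"]) (simp_all add: Der_group_def minus_Der[OF d])
  qed (simp_all add: Der_group_def bch_Der zero_Der)
  show "group ?A"
  proof (rule groupI)
    show "\<one>\<^bsub>?A\<^esub> \<in> carrier ?A"
      using lin_exp_One_Aut[OF zero_Der[where 'a = 'm and 'b = 'k]]
      by (simp add: One_Aut_group_def lin_exp_zero)
    fix \<sigma> assume "\<sigma> \<in> carrier ?A"
    then have "\<sigma> \<in> lin_exp ` Der"
      by (simp add: One_Aut_group_def bij_betw_imp_surj_on[OF bij_betw_lin_exp])
    then obtain d where d: "d \<in> Der" "\<sigma> = lin_exp d" by blast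
    show "\<exists>\<tau>\<in>carrier ?A. \<tau> \<otimes>\<^bsub>?A\<^esub> \<sigma> = \<one>\<^bsub>?A\<^esub>"
      using inv[OF d(1)] lin_exp_One_Aut[OF minus_Der[OF d(1)]]
      by (intro bexI[of _ "lin_exp (\<lambda>v. - d v)"]) (simp_all add: One_Aut_group_def d(2))
  qed (simp_all add: One_Aut_group_def One_Aut_comp o_assoc)
  show "lin_exp \<in> iso ?D ?A"
    by (simp add: iso_def hom_def Der_group_def One_Aut_group_def lin_exp_bch lin_exp_One_Aut
        bij_betw_lin_exp)
qed

end
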